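(* Let $\mathcal{X}$ be a probability distribution on $\mathbb{R}^d\times\{0,1\}$ of pairs $(x,s)$, with $q(0)=P(s=0)$ and $q(1)=P(s=1)$ both positive. Let $D_{train}, D_{val}, D_{test}$ be three mutually independent datasets consisting of $n_{tr}, n_{val}, n_{te}\ge 1$ i.i.d. samples from $\mathcal{X}$, respectively. Let $k\geq 1$, and let $f:\mathbb{R}^d\to\{z_1,\dots,z_k\}\subset\mathbb{R}^{d'}$ (with $z_1,\dots,z_k$ pairwise distinct) be a restricted encoder trained on $D_{train}$, i.e. $f$ may depend (measurably) on $D_{train}$, but $D_{val}$ and $D_{test}$ are not used in any way in its construction. Let $\epsilon=\epsilon_b+\epsilon_c+\epsilon_s\in(0,1)$ with $\epsilon_b,\epsilon_c,\epsilon_s>0$. Define: (1) with $m$ the number of samples in $D_{train}$ with $s=0$, $$\bar\alpha_0=\frac{1}{2B(\frac{\epsilon_b}{2};m,n_{tr}-m+1)},\qquad \bar\alpha_1=\frac{1}{2\left(1-B(1-\frac{\epsilon_b}{2};m+1,n_{tr}-m)\right)};$$ (2) for each $i\in\{1,\dots,k\}$, with $n_i$ the number of samples $(x,s)$ in $D_{val}$ with $f(x)=z_i$ and $m_i$ the number of those that also have $s=0$, $$t_i=\max\left(\bar\alpha_0\, B\left(1-\tfrac{\epsilon_c}{2k};m_i+1,n_i-m_i\right),\ \bar\alpha_1\left(1-B\left(\tfrac{\epsilon_c}{2k};m_i,n_i-m_i+1\right)\right)\right);$$ (3) with $x^{(1)},\dots,x^{(n_{te})}$ the inputs in $D_{test}$,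 $idx(z_i)=i$, $a=\min_i t_i$ and $b=\max_i t_i$, $$S^\star=\frac{1}{n_{te}}\sum_{j=1}^{n_{te}}t_{idx(f(x^{(j)}))}+(b-a)\sqrt{\frac{-\log\epsilon_s}{2n_{te}}},\qquad T^\star=2S^\star-1.$$ Then, with probability at least $1-\epsilon$ over the sampling of the data, simultaneously for every (measurable) classifier $g:\mathbb{R}^{d'}\to\{0,1\}$, $$\Delta^{DP}_{\mathcal{Z}_0,\mathcal{Z}_1}(g)\ \le\ 2\cdot BA_{\mathcal{Z}_0,\mathcal{Z}_1}(h^\star)-1\ \le\ 2S^\star-1=T^\star .$$
   Context: $\mathcal{Z}$ denotes the joint distribution of $(z,s)=(f(x),s)$ for a fresh $(x,s)\sim\mathcal{X}$ with $f$ held fixed (i.e. conditionally on $D_{train}$), and $\mathcal{Z}_0,\mathcal{Z}_1$ denote the conditional distributions of $z$ given $s=0$ and $s=1$. An encoder is called restricted if it takes only finitely many values $z_1,\dots,z_k$ ("cells"). Demographic parity distance of $g:\mathbb{R}^{d'}\to\{0,1\}$: $\Delta^{DP}_{\mathcal{Z}_0,\mathcal{Z}_1}(g)=\left|\mathbb{E}_{z\sim\mathcal{Z}_0}[g(z)]-\mathbb{E}_{z\sim\mathcal{Z}_1}[g(z)]\right|$. Balanced accuracy of an adversary $h:\mathbb{R}^{d'}\to\{0,1\}$ predicting $s$ from $z$: $BA_{\mathcal{Z}_0,\mathcal{Z}_1}(h)=\frac12\left(\mathbb{E}_{z\sim\mathcal{Z}_0}[1-h(z)]+\mathbb{E}_{z\sim\mathcal{Z}_1}[h(z)]\right)$.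 The optimal adversary $h^\star$ is one with $BA_{\mathcal{Z}_0,\mathcal{Z}_1}(h^\star)\ge BA_{\mathcal{Z}_0,\mathcal{Z}_1}(h)$ for all $h$; explicitly $h^\star(z)=1$ if $P(z\mid s=1)\ge P(z\mid s=0)$ and $h^\star(z)=0$ otherwise. $B(p;v,w)$ denotes the $p$-th quantile of the Beta distribution with parameters $v,w$, with the usual Clopper-Pearson conventions $B(p;0,w)=0$ for $w>0$ and $B(p;v,0)=1$ for $v>0$. A fraction with denominator $0$ is read as $+\infty$, and if $\bar\alpha_0$ or $\bar\alpha_1$ is $+\infty$ then $S^\star$ is read as $+\infty$. *)

theory Defs
  imports "HOL-Probability.Probability"
begin

text \<open>The sensitive attribute \<open>s\<close> and the outputs of classifiers and adversaries range over
  \<open>bool\<close>, with \<open>False\<close> for 0 and \<open>True\<close> for 1.\<close>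

definition sample_algebra :: "('a::topological_space \<times> bool) measure" where
  "sample_algebra = borel \<Otimes>\<^sub>M count_space UNIV"


section \<open>Representations, fairness and adversaries\<close>

definition repr_dist ::
    "('a \<times> bool) measure \<Rightarrow> ('a \<Rightarrow> 'b::topological_space) \<Rightarrow> ('b \<times> bool) measure" where
  "repr_dist X f = distr X sample_algebra (\<lambda>(x, s). (f x, s))"

text \<open>The conditional distribution of \<open>z\<close> given the value \<open>s\<close> of the sensitive attribute.\<close>

definition cond_repr_dist ::
    "('a \<times> bool) measure \<Rightarrow> ('a \<Rightarrow> 'b::topological_space) \<Rightarrow> bool \<Rightarrow> 'b measure" where
  "cond_repr_dist X f s = distr (uniform_measure (repr_dist X f) (UNIV \<times> {s})) borel fst"

definition classifiers :: "('b::topological_space \<Rightarrow> bool) set" where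
  "classifiers = borel \<rightarrow>\<^sub>M count_space UNIV"

definition dp_distance :: "'b measure \<Rightarrow> 'b measure \<Rightarrow> ('b \<Rightarrow> bool) \<Rightarrow> real" where
  "dp_distance Z0 Z1 g = \<bar>(\<integral>z. of_bool (g z) \<partial>Z0) - (\<integral>z. of_bool (g z) \<partial>Z1)\<bar>"

definition balanced_accuracy :: "'b measure \<Rightarrow> 'b measure \<Rightarrow> ('b \<Rightarrow> bool) \<Rightarrow> real" where
  "balanced_accuracy Z0 Z1 h =
     1 / 2 * ((\<integral>z. 1 - of_bool (h z) \<partial>Z0) + (\<integral>z. of_bool (h z) \<partial>Z1))"

definition optimal_adversary ::
    "'b::topological_space measure \<Rightarrow> 'b measure \<Rightarrow> ('b \<Rightarrow> bool) \<Rightarrow> bool" where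
  "optimal_adversary Z0 Z1 h \<longleftrightarrow>
     h \<in> classifiers \<and>
     (\<forall>h'\<in>classifiers. balanced_accuracy Z0 Z1 h' \<le> balanced_accuracy Z0 Z1 h)"


section \<open>Quantiles of the Beta distribution\<close>

definition beta_measure :: "real \<Rightarrow> real \<Rightarrow> real measure" where
  "beta_measure v w = density lborel
     (\<lambda>x. ennreal (indicator {0<..<1} x * (x powr (v - 1) * (1 - x) powr (w - 1) / Beta v w)))"

definition quantile :: "real measure \<Rightarrow> real \<Rightarrow> real" where
  "quantile M p = Inf {x. p \<le> cdf M x}"

text \<open>Clopper-Pearson conventions are used when one of the parameters is 0; the value for
  \<open>v = w = 0\<close> is irrelevant.\<close>

definition beta_quantile :: "real \<Rightarrow> real \<Rightarrow> real \<Rightarrow> real" where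
  "beta_quantile p v w =
     (if v = 0 then 0 else if w = 0 then 1 else quantile (beta_measure v w) p)"


section \<open>Datasets and the bound\<close>

type_synonym 'a dataset = "nat \<Rightarrow> 'a \<times> bool"

text \<open>The law of \<open>n\<close> i.i.d. samples from \<open>X\<close>, indexed by \<open>0, \<dots>, n - 1\<close>.\<close>

definition dataset_dist :: "nat \<Rightarrow> ('a \<times> bool) measure \<Rightarrow> 'a dataset measure" where
  "dataset_dist n X = Pi\<^sub>M {..<n} (\<lambda>_. X)"

definition count_s0 :: "nat \<Rightarrow> 'a dataset \<Rightarrow> nat" where
  "count_s0 n D = card {j \<in> {..<n}. \<not> snd (D j)}"

definition count_cell :: "nat \<Rightarrow> ('a \<Rightarrow> 'b) \<Rightarrow> 'b \<Rightarrow> 'a dataset \<Rightarrow> nat" where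
  "count_cell n f c D = card {j \<in> {..<n}. f (fst (D j)) = c}"

definition count_cell_s0 :: "nat \<Rightarrow> ('a \<Rightarrow> 'b) \<Rightarrow> 'b \<Rightarrow> 'a dataset \<Rightarrow> nat" where
  "count_cell_s0 n f c D = card {j \<in> {..<n}. f (fst (D j)) = c \<and> \<not> snd (D j)}"

text \<open>Division in \<open>ereal\<close> satisfies \<open>1 / 0 = \<infinity>\<close>.\<close>

definition alpha0 :: "real \<Rightarrow> nat \<Rightarrow> nat \<Rightarrow> ereal" where
  "alpha0 eps_b n m = 1 / ereal (2 * beta_quantile (eps_b / 2) (real m) (real n - real m + 1))"

definition alpha1 :: "real \<Rightarrow> nat \<Rightarrow> nat \<Rightarrow> ereal" where
  "alpha1 eps_b n m =
     1 / ereal (2 * (1 - beta_quantile (1 - eps_b / 2) (real m + 1) (real n - real m)))"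

definition cell_bound :: "ereal \<Rightarrow> ereal \<Rightarrow> real \<Rightarrow> nat \<Rightarrow> nat \<Rightarrow> nat \<Rightarrow> ereal" where
  "cell_bound a0 a1 eps_c k n m =
     max (a0 * ereal (beta_quantile (1 - eps_c / (2 * real k)) (real m + 1) (real n - real m)))
         (a1 * ereal (1 - beta_quantile (eps_c / (2 * real k)) (real m) (real n - real m + 1)))"

text \<open>\<open>z 1, \<dots>, z k\<close> are the cells of the encoder \<open>f\<close>.\<close>

definition S_star ::
    "real \<Rightarrow> real \<Rightarrow> real \<Rightarrow> nat \<Rightarrow> nat \<Rightarrow> nat \<Rightarrow> nat \<Rightarrow> ('a \<Rightarrow> 'b) \<Rightarrow> (nat \<Rightarrow> 'b) \<Rightarrow>
     'a dataset \<Rightarrow> 'a dataset \<Rightarrow> 'a dataset \<Rightarrow> ereal" where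
  "S_star eps_b eps_c eps_s k ntr nval nte f z Dtr Dval Dte =
    (let m = count_s0 ntr Dtr;
         a0 = alpha0 eps_b ntr m;
         a1 = alpha1 eps_b ntr m;
         t = (\<lambda>i. cell_bound a0 a1 eps_c k
                   (count_cell nval f (z i) Dval) (count_cell_s0 nval f (z i) Dval));
         idx = the_inv_into {1..k} z;
         a = Min (t ` {1..k});
         b = Max (t ` {1..k})
     in if a0 = \<infinity> \<or> a1 = \<infinity> then \<infinity>
        else ereal (1 / real nte) * (\<Sum>j<nte. t (idx (f (fst (Dte j)))))
             + (b - a) * ereal (sqrt (- ln eps_s / (2 * real nte))))"

definition T_star ::
    "real \<Rightarrow> real \<Rightarrow> real \<Rightarrow> nat \<Rightarrow> nat \<Rightarrow> nat \<Rightarrow> nat \<Rightarrow> ('a \<Rightarrow> 'b) \<Rightarrow> (nat \<Rightarrow> 'b) \<Rightarrow>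
     'a dataset \<Rightarrow> 'a dataset \<Rightarrow> 'a dataset \<Rightarrow> ereal" where
  "T_star eps_b eps_c eps_s k ntr nval nte f z Dtr Dval Dte =
     2 * S_star eps_b eps_c eps_s k ntr nval nte f z Dtr Dval Dte - 1"


section \<open>Existence of optimal adversaries for restricted encoders\<close>

lemma prob_space_cond_repr_dist:
  assumes X: "prob_space X" "sets X = sets sample_algebra"
    and f: "f \<in> borel_measurable borel" and q: "measure X (UNIV \<times> {s}) > 0"
  shows "prob_space (cond_repr_dist X f s)"
proof -
  interpret prob_space X by fact
  have m: "(\<lambda>(x, s). (f x, s)) \<in> X \<rightarrow>\<^sub>M sample_algebra"
    using f unfolding measurable_cong_sets[OF X(2) refl] sample_algebra_def by measurable
  interpret R: prob_space "repr_dist X f"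
    unfolding repr_dist_def by (rule prob_space_distr[OF m])
  have sp: "space X = UNIV"
    using sets_eq_imp_space_eq[OF X(2)] by (simp add: sample_algebra_def space_pair_measure)
  have S: "UNIV \<times> {s} \<in> sets sample_algebra"
    unfolding sample_algebra_def by auto
  have "measure (repr_dist X f) (UNIV \<times> {s}) = measure X (UNIV \<times> {s})"
    unfolding repr_dist_def by (subst measure_distr[OF m S]) (auto simp: sp intro!: arg_cong2[where f=measure])
  with q have "emeasure (repr_dist X f) (UNIV \<times> {s}) \<noteq> 0"
    by (simp add: R.emeasure_eq_measure)
  then interpret U: prob_space "uniform_measure (repr_dist X f) (UNIV \<times> {s})"
    by (intro prob_space_uniform_measure) auto
  have "fst \<in> uniform_measure (repr_dist X f) (UNIV \<times> {s}) \<rightarrow>\<^sub>M borel"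
    by (simp add: repr_dist_def sample_algebra_def)
  then show ?thesis
    unfolding cond_repr_dist_def by (rule U.prob_space_distr)
qed

lemma integral_classifier_finite_support:
  fixes Z :: "'b::t1_space measure"
  assumes Z: "prob_space Z" "sets Z = sets borel" and C: "finite C" "AE z in Z. z \<in> C"
    and h: "h \<in> classifiers"
  shows "(\<integral>z. of_bool (h z) \<partial>Z) = (\<Sum>z\<in>C. of_bool (h z) * measure Z {z})"
    and "(\<integral>z. 1 - of_bool (h z) \<partial>Z) = 1 - (\<Sum>z\<in>C. of_bool (h z) * measure Z {z})"
proof -
  interpret prob_space Z by fact
  have m[measurable]: "(\<lambda>z. of_bool (h z) :: real) \<in> borel_measurable Z"
  proof -
    have [measurable]: "h \<in> Z \<rightarrow>\<^sub>M count_space UNIV"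
      using h by (simp add: classifiers_def measurable_cong_sets[OF Z(2) refl])
    show ?thesis by measurable
  qed
  have sg: "{z} \<in> sets Z" for z using Z(2) by simp
  have "(\<integral>z. of_bool (h z) \<partial>Z) = (\<integral>z. (\<Sum>c\<in>C. of_bool (h c) * indicator {c} z :: real) \<partial>Z)"
  proof (rule integral_cong_AE)
    have "of_bool (h z) = (\<Sum>c\<in>C. of_bool (h c) * indicator {c} z :: real)" if "z \<in> C" for z
    proof -
      have "(\<Sum>c\<in>C. of_bool (h c) * indicator {c} z) = (\<Sum>c\<in>C. if c = z then of_bool (h c) else (0::real))"
        by (intro sum.cong) (auto simp: indicator_def)
      with that C(1) show ?thesis by simp
    qed
    then show "AE z in Z. (of_bool (h z) :: real) = (\<Sum>c\<in>C. of_bool (h c) * indicator {c} z)"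
      using C(2) by (rule eventually_mono[rotated])
  qed (use sg in measurable)
  also have "\<dots> = (\<Sum>c\<in>C. of_bool (h c) * measure Z {c})"
    using sg by (subst Bochner_Integration.integral_sum) (auto simp: emeasure_eq_measure)
  finally show 1: "(\<integral>z. of_bool (h z) \<partial>Z) = (\<Sum>z\<in>C. of_bool (h z) * measure Z {z})" .
  have "integrable Z (\<lambda>z. of_bool (h z) :: real)"
    by (rule integrable_const_bound[where B=1]) auto
  then show "(\<integral>z. 1 - of_bool (h z) \<partial>Z) = 1 - (\<Sum>z\<in>C. of_bool (h z) * measure Z {z})"
    using 1 by (simp add: prob_space)
qed

lemma optimal_adversary_explicit:
  fixes f :: "'a::topological_space \<Rightarrow> 'b::t1_space"
  assumes X: "prob_space X" "sets X = sets sample_algebra"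
    and f: "f \<in> borel_measurable borel" "finite (range f)"
    and q: "\<And>s. measure X (UNIV \<times> {s}) > 0"
  shows "optimal_adversary (cond_repr_dist X f False) (cond_repr_dist X f True)
    (\<lambda>z. measure (cond_repr_dist X f True) {z} \<ge> measure (cond_repr_dist X f False) {z})"
proof -
  let ?Z = "cond_repr_dist X f"
  let ?C = "range f"
  let ?h = "\<lambda>z. measure (?Z True) {z} \<ge> measure (?Z False) {z}"
  have P: "prob_space (?Z s)" for s
    by (rule prob_space_cond_repr_dist[OF X f(1) q])
  have sets: "sets (?Z s) = sets borel" for s
    by (simp add: cond_repr_dist_def)
  have C: "?C \<in> sets borel"
    using f(2) by (intro borel_closed finite_imp_closed)
  have m: "(\<lambda>(x, s). (f x, s)) \<in> X \<rightarrow>\<^sub>M sample_algebra"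
    using f(1) unfolding measurable_cong_sets[OF X(2) refl] sample_algebra_def by measurable
  have AE: "AE z in ?Z s. z \<in> ?C" for s
  proof -
    have SC: "{x \<in> space sample_algebra. fst x \<in> ?C} \<in> sets sample_algebra"
      using C unfolding sample_algebra_def by measurable
    have "AE x in repr_dist X f. fst x \<in> ?C"
      unfolding repr_dist_def by (subst AE_distr_iff[OF m SC]) auto
    moreover have "UNIV \<times> {s} \<in> sets (repr_dist X f)"
      by (auto simp: repr_dist_def sample_algebra_def)
    ultimately have "AE x in uniform_measure (repr_dist X f) (UNIV \<times> {s}). fst x \<in> ?C"
      by (intro AE_uniform_measureI) auto
    moreover have "fst \<in> uniform_measure (repr_dist X f) (UNIV \<times> {s}) \<rightarrow>\<^sub>M borel"
      by (simp add: repr_dist_def sample_algebra_def)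
    ultimately show ?thesis
      unfolding cond_repr_dist_def using C by (subst AE_distr_iff) auto
  qed
  have null: "measure (?Z s) {z} = 0" if "z \<notin> ?C" for s z
  proof -
    interpret prob_space "?Z s" by (rule P)
    have "AE x in ?Z s. x \<notin> {z}"
      using AE[of s] that by (auto elim: eventually_mono)
    then have "prob {z} = 0"
      by (subst (asm) AE_iff_measurable[OF _ refl]) (auto simp: sets sets_eq_imp_space_eq[OF sets] measure_def)
    then show ?thesis .
  qed
  have hm: "?h \<in> classifiers"
  proof -
    have *: "{z. \<not> ?h z} \<subseteq> ?C" using null by force
    then have "{z. \<not> ?h z} \<in> sets borel"
      using f(2) by (intro borel_closed finite_imp_closed) (rule finite_subset)
    then have "Measurable.pred borel (\<lambda>z. \<not> ?h z)"
      by (simp add: pred_def)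
    then have "Measurable.pred borel (\<lambda>z. \<not> \<not> ?h z)" by measurable
    then show ?thesis by (simp add: classifiers_def)
  qed
  have BA: "balanced_accuracy (?Z False) (?Z True) h =
      1/2 * (1 + (\<Sum>z\<in>?C. of_bool (h z) * (measure (?Z True) {z} - measure (?Z False) {z})))"
    if "h \<in> classifiers" for h
    unfolding balanced_accuracy_def
      integral_classifier_finite_support[OF P sets f(2) AE that]
    by (simp add: right_diff_distrib sum_subtractf)
  have "balanced_accuracy (?Z False) (?Z True) h \<le> balanced_accuracy (?Z False) (?Z True) ?h"
    if "h \<in> classifiers" for h
    unfolding BA[OF that] BA[OF hm] by (intro mult_left_mono add_left_mono sum_mono) auto
  with hm show ?thesis by (auto simp: optimal_adversary_def)
qed

end

theory Submission
  imports Defs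
begin

text \<open>Write \<open>q s = P (s)\<close> and \<open>p i s = P (f x = z i, s)\<close>. The best adversary has balanced accuracy
  \<open>1/2 * (\<Sum>i. max (p i 0 / q 0) (p i 1 / q 1))\<close>, which is the expectation over the cell
  \<open>i\<close> of \<open>max (P (s = 0 | i) / (2 * q 0)) (P (s = 1 | i) / (2 * q 1))\<close>. Clopper-Pearson
  bounds for \<open>q 0\<close> (training data) and for each \<open>P (s = 0 | i)\<close> (validation data) bound this
  integrand by \<open>t i\<close>, and Hoeffding's inequality (test data) bounds the mean of \<open>t\<close>. As the optimal
  accuracy is an explicit function of the training data, the event in question is measurable, and
  its failure probability is estimated by fixing the data sets one after the other.\<close>

section \<open>Binomial tails and Clopper-Pearson bounds\<close>

text \<open>The event quantifies over all optimal adversaries and all classifiers, so its form does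
  not show that it is measurable, and \<open>measure\<close> is 0 on a non-measurable set. This is
  why it is rewritten as a single inequality between \<open>optimal_accuracy\<close> and
  \<open>T_star\<close>. The number of validation samples in a cell is itself random. Conditioning
  on which samples fall into the cell makes the count with \<open>s = 0\<close> binomial; the
  Clopper-Pearson bound holds for every cell count and hence survives averaging. Clopper-Pearson
  rests on one identity: the distribution function of the Beta distribution with parameters
  \<open>m\<close> and \<open>n - m + 1\<close> at \<open>p\<close> is the probability of at least
  \<open>m\<close> successes in \<open>n\<close> trials of parameter \<open>p\<close>. A two-sided
  interval costs twice its one-sided level. This explains \<open>eps_b / 2\<close>, spent on one
  interval, and \<open>eps_c / (2 * k)\<close>, spent on \<open>k\<close> of them. The order
  training, validation, test is forced: \<open>t\<close> depends on the first two data sets only, so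
  it consists of constants when Hoeffding's inequality is applied to the third.\<close>

definition binomial_weight :: "nat \<Rightarrow> real \<Rightarrow> nat \<Rightarrow> real" where
  "binomial_weight n p j = real (n choose j) * p ^ j * (1 - p) ^ (n - j)"

definition binomial_tail :: "nat \<Rightarrow> nat \<Rightarrow> real \<Rightarrow> real" where
  "binomial_tail n m p = (\<Sum>j=m..n. binomial_weight n p j)"

lemma binomial_weight_nonneg: "0 \<le> p \<Longrightarrow> p \<le> 1 \<Longrightarrow> 0 \<le> binomial_weight n p j"
  by (simp add: binomial_weight_def)

lemma sum_binomial_weight: "(\<Sum>j\<le>n. binomial_weight n p j) = 1"
  using binomial_ring[of p "1 - p" n] by (simp add: binomial_weight_def)

lemma Beta_nat:
  assumes "1 \<le> m" "m \<le> n"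
  shows "Beta (real m) (real n - real m + 1) = fact (m - 1) * fact (n - m) / fact n"
proof -
  have "Gamma (real m) = fact (m - 1)"
    using Gamma_fact[of "m - 1", where 'a=real] assms by (simp add: of_nat_diff)
  moreover have "Gamma (real n - real m + 1) = fact (n - m)"
    using Gamma_fact[of "n - m", where 'a=real] assms by (simp add: of_nat_diff algebra_simps)
  moreover have "Gamma (real m + (real n - real m + 1)) = fact n"
    using Gamma_fact[of n, where 'a=real] by (simp add: algebra_simps)
  ultimately show ?thesis
    by (simp add: Beta_def)
qed

text \<open>The derivative of the weight at \<open>j\<close> is a difference
  \<open>T j - T (Suc j)\<close>, so the sum telescopes. The surviving term \<open>T m\<close> is
  the Beta density, which makes the tail an antiderivative of it.\<close>

lemma DERIV_binomial_tail:
  assumes m: "1 \<le> m" "m \<le> n"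
  shows "(binomial_tail n m has_real_derivative
     x ^ (m - 1) * (1 - x) ^ (n - m) / Beta (real m) (real n - real m + 1)) (at x)"
proof -
  define T where "T j = real (n choose j) * real j * x ^ (j - 1) * (1 - x) ^ (n - j)" for j
  have step: "((\<lambda>p. binomial_weight n p j) has_real_derivative T j - T (Suc j)) (at x)"
    if "j \<in> {m..n}" for j
  proof -
    have "((n - j) * (n choose j)) = Suc j * (n choose Suc j)"
      by (metis binomial_absorb_comp binomial_absorption diff_Suc_1 mult.commute times_binomial_minus1_eq zero_less_Suc)
    then have e: "real (n - j) * real (n choose j) = real (Suc j) * real (n choose Suc j)"
      by (metis of_nat_mult)
    have "T (Suc j) = real (n choose j) * real (n - j) * x ^ j * (1 - x) ^ (n - Suc j)"
      using e by (simp add: T_def mult.commute)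
    then show ?thesis
      unfolding binomial_weight_def T_def
      by (auto intro!: derivative_eq_intros simp: algebra_simps)
  qed
  have "(binomial_tail n m has_real_derivative (\<Sum>j=m..n. T j - T (Suc j))) (at x)"
    unfolding binomial_tail_def using step by (intro DERIV_sum) auto
  \<comment> \<open>The other end of the telescoping sum, \<open>T (Suc n)\<close>, is 0 because
    \<open>n choose Suc n = 0\<close>.\<close>
  also have "(\<Sum>j=m..n. T j - T (Suc j)) = T m"
    using sum_Suc_diff[of m n "\<lambda>j. - T j"] m by (simp add: T_def)
  also have "T m = x ^ (m - 1) * (1 - x) ^ (n - m) / Beta (real m) (real n - real m + 1)"
  proof -
    have "fact m = real m * (fact (m - 1) :: real)"
      using m by (subst fact_reduce) auto
    then show ?thesis
      using m unfolding T_def Beta_nat[OF m] by (simp add: binomial_fact field_simps)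
  qed
  finally show ?thesis .
qed


lemma binomial_tail_nonneg: "0 \<le> p \<Longrightarrow> p \<le> 1 \<Longrightarrow> 0 \<le> binomial_tail n m p"
  unfolding binomial_tail_def by (intro sum_nonneg binomial_weight_nonneg)

lemma binomial_tail_0: "1 \<le> m \<Longrightarrow> binomial_tail n m 0 = 0"
  unfolding binomial_tail_def by (intro sum.neutral) (auto simp: binomial_weight_def)

lemma binomial_tail_1:
  assumes "m \<le> n" shows "binomial_tail n m 1 = 1"
proof -
  have "binomial_tail n m 1 = (\<Sum>j=m..n. if j = n then 1 else 0)"
    unfolding binomial_tail_def by (intro sum.cong) (auto simp: binomial_weight_def)
  with assms show ?thesis by simp
qed

lemma sum_binomial_weight_add_tail:
  assumes "m \<le> n"
  shows "(\<Sum>j\<le>m. binomial_weight n p j) + binomial_tail n (Suc m) p = 1"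
proof -
  have "{..n} = {..m} \<union> {Suc m..n}" using assms by auto
  then show ?thesis
    using sum_binomial_weight[of n p] unfolding binomial_tail_def
    by (simp add: sum.union_disjoint)
qed

lemma Beta_nat_pos:
  "1 \<le> m \<Longrightarrow> m \<le> n \<Longrightarrow> 0 < Beta (real m) (real n - real m + 1)"
  by (simp add: Beta_nat)

lemma binomial_tail_mono:
  assumes "1 \<le> m" "m \<le> n" "0 \<le> x" "x \<le> y" "y \<le> 1"
  shows "binomial_tail n m x \<le> binomial_tail n m y"
proof (rule DERIV_nonneg_imp_nondecreasing[OF assms(4)])
  fix u assume "x \<le> u" "u \<le> y"
  with assms have "0 \<le> u ^ (m - 1) * (1 - u) ^ (n - m) / Beta (real m) (real n - real m + 1)"
    using Beta_nat_pos[OF assms(1,2)] by simp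
  then show "\<exists>d. (binomial_tail n m has_real_derivative d) (at u) \<and> 0 \<le> d"
    using DERIV_binomial_tail[OF assms(1,2)] by blast
qed

text \<open>The density is the derivative of \<open>binomial_tail n m\<close>, so the fundamental
  theorem of calculus applies. The case \<open>x \<le> 0\<close> and the cut at 1 appear because the
  polynomial is a distribution function only on the unit interval.\<close>

lemma emeasure_beta_measure_atMost:
  assumes m: "1 \<le> m" "m \<le> n"
  shows "emeasure (beta_measure (real m) (real n - real m + 1)) {..x} =
    ennreal (if x \<le> 0 then 0 else binomial_tail n m (min x 1))"
proof -
  let ?B = "Beta (real m) (real n - real m + 1)"
  let ?f = "\<lambda>u::real. indicator {0<..<1} u * (u powr (real m - 1) * (1 - u) powr (real n - real m + 1 - 1) / ?B)"
  let ?g = "\<lambda>u::real. u ^ (m - 1) * (1 - u) ^ (n - m) / ?B"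
  have f_eq: "?f u = indicator {0<..<1} u * ?g u" for u :: real
  proof (cases "u \<in> {0<..<1}")
    case True
    then have "u powr real (m - 1) = u ^ (m - 1)" "(1 - u) powr real (n - m) = (1 - u) ^ (n - m)"
      by (auto intro: powr_realpow)
    with m show ?thesis by (simp add: of_nat_diff)
  qed simp
  have "emeasure (beta_measure (real m) (real n - real m + 1)) {..x} =
      (\<integral>\<^sup>+u. ennreal (?f u) * indicator {..x} u \<partial>lborel)"
    unfolding beta_measure_def by (subst emeasure_density) auto
  also have "\<dots> = ennreal (if x \<le> 0 then 0 else binomial_tail n m (min x 1))"
  proof (cases "x \<le> 0")
    case True
    then have "(\<integral>\<^sup>+u. ennreal (?f u) * indicator {..x} u \<partial>lborel) = (\<integral>\<^sup>+u. 0 \<partial>(lborel::real measure))"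
      by (intro nn_integral_cong) (auto simp: indicator_def)
    with True show ?thesis by simp
  next
    case False
    have "(\<integral>\<^sup>+u. ennreal (?f u) * indicator {..x} u \<partial>lborel) =
        (\<integral>\<^sup>+u. ennreal (?g u) * indicator {0..min x 1} u \<partial>lborel)"
    proof (rule nn_integral_cong_AE)
      \<comment> \<open>One indicator is open and the other closed, so the integrands agree except
        possibly at the null points 0 and 1.\<close>
      show "AE u in lborel. ennreal (?f u) * indicator {..x} u = ennreal (?g u) * indicator {0..min x 1} u"
        using AE_lborel_singleton[of 0] AE_lborel_singleton[of 1]
        by eventually_elim (unfold f_eq, auto simp: indicator_def)
    qed
    also have "\<dots> = binomial_tail n m (min x 1) - binomial_tail n m 0"
    proof (rule nn_integral_FTC_Icc)
      show "?g \<in> borel_measurable borel" by measurable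
      show "(binomial_tail n m has_real_derivative ?g u) (at u)" for u
        by (rule DERIV_binomial_tail[OF m])
      show "0 \<le> ?g u" if "u \<in> {0..min x 1}" for u
        using that Beta_nat_pos[OF m] by auto
    qed (use False in auto)
    finally show ?thesis
      using False binomial_tail_0[OF m(1)] by simp
  qed
  finally show ?thesis .
qed

lemma cdf_beta_measure:
  assumes m: "1 \<le> m" "m \<le> n"
  shows "cdf (beta_measure (real m) (real n - real m + 1)) x =
    (if x \<le> 0 then 0 else binomial_tail n m (min x 1))"
  using emeasure_beta_measure_atMost[OF m, of x]
  by (auto simp: cdf_def measure_def binomial_tail_nonneg)

section \<open>Quantiles of Beta distributions with integer parameters\<close>

context
  fixes m n :: nat and e :: real
  assumes m: "1 \<le> m" "m \<le> n" and e: "0 < e" "e < 1"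
begin

text \<open>Since \<open>e > 0\<close> and the distribution function is 0 on the non-positive reals,
  only positive \<open>x\<close> qualify. The set is therefore bounded below, as the infimum
  requires.\<close>

private lemma beta_quantile_eq:
  "beta_quantile e (real m) (real n - real m + 1) =
    Inf {x. 0 < x \<and> e \<le> binomial_tail n m (min x 1)}" (is "_ = Inf ?S")
proof -
  have "real n - real m + 1 \<noteq> 0" using m by linarith
  moreover have "{x. e \<le> cdf (beta_measure (real m) (real n - real m + 1)) x} = ?S"
    using e by (auto simp: cdf_beta_measure[OF m])
  ultimately show ?thesis
    using m by (simp add: beta_quantile_def quantile_def)
qed

lemma beta_quantile_le:
  assumes "0 \<le> p" "p \<le> 1" "e \<le> binomial_tail n m p"
  shows "beta_quantile e (real m) (real n - real m + 1) \<le> p"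
  unfolding beta_quantile_eq
proof (rule cInf_lower)
  have "p \<noteq> 0" using assms(3) binomial_tail_0[OF m(1), of n] e by auto
  with assms show "p \<in> {x. 0 < x \<and> e \<le> binomial_tail n m (min x 1)}" by simp
qed (auto intro!: bdd_belowI[of _ 0])

lemma beta_quantile_le_1: "beta_quantile e (real m) (real n - real m + 1) \<le> 1"
  using beta_quantile_le[of 1] binomial_tail_1[OF m(2)] e by simp

lemma beta_quantile_nonneg: "0 \<le> beta_quantile e (real m) (real n - real m + 1)"
  unfolding beta_quantile_eq
proof (rule cInf_greatest)
  have "1 \<in> {x. 0 < x \<and> e \<le> binomial_tail n m (min x 1)}"
    using binomial_tail_1[OF m(2)] e by simp
  then show "{x. 0 < x \<and> e \<le> binomial_tail n m (min x 1)} \<noteq> {}" by blast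
qed auto

text \<open>The strict inequality puts an element of the set below \<open>p\<close>, and
  monotonicity of the tail carries its bound up to \<open>p\<close>.\<close>

lemma le_binomial_tail_if_beta_quantile_less:
  assumes "p \<le> 1" "beta_quantile e (real m) (real n - real m + 1) < p"
  shows "e \<le> binomial_tail n m p"
proof -
  let ?S = "{x. 0 < x \<and> e \<le> binomial_tail n m (min x 1)}"
  have "1 \<in> ?S"
    using binomial_tail_1[OF m(2)] e by simp
  then have "?S \<noteq> {}" by blast
  from cInf_lessD[OF this assms(2)[unfolded beta_quantile_eq]]
  obtain x where x: "0 < x" "e \<le> binomial_tail n m (min x 1)" "x < p" by auto
  have "binomial_tail n m x \<le> binomial_tail n m p"
    using x assms by (intro binomial_tail_mono[OF m]) auto
  with x assms show ?thesis by (simp add: min_def)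
qed

end

lemma beta_quantile_lower_nonneg:
  assumes "j \<le> n" "0 < e" "e < 1"
  shows "0 \<le> beta_quantile e (real j) (real n - real j + 1)"
  using beta_quantile_nonneg[of j n e] assms
  by (cases "j = 0") (auto simp: beta_quantile_def)

text \<open>The parameters \<open>j + 1\<close> and \<open>n - j\<close> are those of the tail
  starting at \<open>Suc j\<close>. For \<open>j = n\<close> that tail is empty and the convention
  for a zero second parameter takes over.\<close>

lemma beta_quantile_upper_le_1:
  assumes "j \<le> n" "0 < e" "e < 1"
  shows "beta_quantile e (real j + 1) (real n - real j) \<le> 1"
  using beta_quantile_le_1[of "Suc j" n e] assms
  by (cases "j = n") (auto simp: beta_quantile_def algebra_simps)

section \<open>Clopper-Pearson bounds for binomial counts\<close>

text \<open>All bad counts are at least the smallest one, \<open>l\<close>, so their total weight is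
  at most the upper tail from \<open>l\<close>. This tail is below \<open>e\<close> because
  \<open>l\<close> is bad itself. The convention for a zero first parameter makes the count 0 never
  bad.\<close>

lemma clopper_pearson_lower:
  assumes p: "0 \<le> p" "p \<le> 1" and e: "0 < e" "e < 1"
  shows "(\<Sum>j | j \<le> n \<and> p < beta_quantile e (real j) (real n - real j + 1). binomial_weight n p j) \<le> e"
    (is "sum _ ?A \<le> e")
proof (cases "?A = {}")
  case False
  have fin: "finite ?A" by simp
  define l where "l = Min ?A"
  have l: "l \<in> ?A" unfolding l_def using False fin by (intro Min_in)
  then have "l \<noteq> 0" using p by (auto simp: beta_quantile_def intro!: gr0I)
  then have "binomial_tail n l p < e"
    using l beta_quantile_le[of l n e p] p e by fastforce
  moreover have "sum (binomial_weight n p) ?A \<le> binomial_tail n l p"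
    unfolding binomial_tail_def
    by (intro sum_mono2) (auto simp: l_def p binomial_weight_nonneg)
  ultimately show ?thesis by linarith
next
  case True
  show ?thesis unfolding True using e by simp
qed

text \<open>Dual argument with the largest bad count \<open>l\<close>: its badness says that the
  tail from \<open>Suc l\<close> has weight at least \<open>1 - e\<close>, leaving at most
  \<open>e\<close> for the counts up to \<open>l\<close>. The count \<open>n\<close> is never bad,
  its bound being 1.\<close>

lemma clopper_pearson_upper:
  assumes p: "0 \<le> p" "p \<le> 1" and e: "0 < e" "e < 1"
  shows "(\<Sum>j | j \<le> n \<and> beta_quantile (1 - e) (real j + 1) (real n - real j) < p. binomial_weight n p j) \<le> e"
    (is "sum _ ?A \<le> e")
proof (cases "?A = {}")
  case False
  have fin: "finite ?A" by simp
  define l where "l = Max ?A"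
  have l: "l \<in> ?A" unfolding l_def using False fin by (intro Max_in)
  then have "l \<noteq> n" using p by (auto simp: beta_quantile_def)
  then have "1 - e \<le> binomial_tail n (Suc l) p"
    using l le_binomial_tail_if_beta_quantile_less[of "Suc l" n "1 - e" p] p e
    by (auto simp: algebra_simps)
  moreover have "sum (binomial_weight n p) ?A \<le> sum (binomial_weight n p) {..l}"
    by (intro sum_mono2) (auto simp: l_def p binomial_weight_nonneg)
  ultimately show ?thesis
    using sum_binomial_weight_add_tail[of l n p] l by auto
next
  case True
  show ?thesis unfolding True using e by simp
qed

section \<open>Product measures\<close>

text \<open>Patterns of samples matter only through their size. This passes from index sets to
  binomial coefficients, both for the samples in \<open>A\<close> and for those among them in
  \<open>B\<close>.\<close>

lemma sum_subsets_by_card: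
  fixes g :: "nat \<Rightarrow> real"
  assumes "finite I"
  shows "(\<Sum>J | J \<subseteq> I \<and> Q (card J). g (card J)) = (\<Sum>j | j \<le> card I \<and> Q j. real (card I choose j) * g j)"
proof -
  let ?S = "{J. J \<subseteq> I \<and> Q (card J)}" and ?T = "{j. j \<le> card I \<and> Q j}"
  have fin: "finite ?S" using assms by simp
  have "(\<Sum>J\<in>?S. g (card J)) = (\<Sum>j\<in>?T. \<Sum>J | J \<in> ?S \<and> card J = j. g (card J))"
    using assms fin by (intro sum.group[symmetric]) (auto intro: card_mono)
  also have "\<dots> = (\<Sum>j\<in>?T. real (card I choose j) * g j)"
  proof (rule sum.cong)
    fix j assume "j \<in> ?T"
    then have "{J. J \<in> ?S \<and> card J = j} = {J. J \<subseteq> I \<and> card J = j}" by auto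
    then show "(\<Sum>J | J \<in> ?S \<and> card J = j. g (card J)) = real (card I choose j) * g j"
      using n_subsets[OF assms, of j] by simp
  qed simp
  finally show ?thesis .
qed

text \<open>Given which samples lie in \<open>A\<close>, the number of samples in \<open>B\<close> is binomial with parameter
  \<open>P (B | A)\<close>; the bound therefore only has to be checked for binomial distributions. If \<open>A\<close> is a
  null set, the quotient is 0 and the parameter is irrelevant.\<close>

lemma prob_counts_le:
  assumes M: "prob_space M" and AB: "A \<in> sets M" "B \<in> sets M" "B \<subseteq> A"
    and P: "\<And>N. N \<le> n \<Longrightarrow>
      (\<Sum>j | j \<le> N \<and> P N j. binomial_weight N (measure M B / measure M A) j) \<le> e"
  shows "measure (Pi\<^sub>M {..<n} (\<lambda>_. M))
    {D \<in> space (Pi\<^sub>M {..<n} (\<lambda>_. M)). P (card {j\<in>{..<n}. D j \<in> A}) (card {j\<in>{..<n}. D j \<in> B})} \<le> e"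
    (is "measure ?M ?S \<le> e")
proof -
  interpret M: prob_space M by fact
  interpret PM: finite_product_prob_space "\<lambda>_. M" "{..<n}" by unfold_locales simp
  define a b where "a = measure M A" and "b = measure M B"
  have ab: "0 \<le> b" "b \<le> a" "a \<le> 1"
    using AB by (auto simp: a_def b_def intro: M.finite_measure_mono)
  \<comment> \<open>For \<open>J \<subseteq> I\<close>, this is the box of data sets whose samples
    lie in \<open>A\<close> exactly at the indices in \<open>I\<close> and in \<open>B\<close>
    exactly at those in \<open>J\<close>.\<close>
  define E where "E I J = Pi\<^sub>E {..<n} (\<lambda>j. if j \<in> J then B else if j \<in> I then A - B else space M - A)"
    for I J :: "nat set"
  have E_sets: "E I J \<in> sets ?M" for I J
    unfolding E_def using AB by (intro sets_PiM_I_finite) auto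
  have E_measure: "measure ?M (E I J) = b ^ card J * (a - b) ^ (card I - card J) * (1 - a) ^ (n - card I)"
    if IJ: "I \<subseteq> {..<n}" "J \<subseteq> I" for I J
  proof -
    have fin: "finite I" "finite J" using IJ by (auto intro: finite_subset)
    have disj: "(J \<union> (I - J)) \<inter> ({..<n} - I) = {}" "J \<inter> (I - J) = {}" using IJ by auto
    have "measure ?M (E I J) = (\<Prod>j<n. if j \<in> J then b else if j \<in> I then a - b else 1 - a)"
      unfolding E_def using AB
      by (subst PM.finite_measure_PiM_emb)
         (auto intro!: prod.cong simp: a_def b_def M.finite_measure_Diff M.prob_compl)
    also have "\<dots> = (\<Prod>j\<in>J \<union> (I - J) \<union> ({..<n} - I). if j \<in> J then b else if j \<in> I then a - b else 1 - a)"
    proof (rule prod.cong)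
      show "{..<n} = J \<union> (I - J) \<union> ({..<n} - I)" using IJ by blast
    qed (rule refl)
    also have "\<dots> = (\<Prod>j\<in>J. b) * (\<Prod>j\<in>I - J. a - b) * (\<Prod>j\<in>{..<n} - I. 1 - a)"
      unfolding prod.union_disjoint[OF finite_UnI[OF fin(2) finite_Diff[OF fin(1)]] finite_Diff[OF finite_lessThan] disj(1)]
        prod.union_disjoint[OF fin(2) finite_Diff[OF fin(1)] disj(2)]
      using IJ by (intro arg_cong2[where f="(*)"] prod.cong refl) auto
    finally show ?thesis
      using IJ fin by (simp add: card_Diff_subset)
  qed
  let ?I = "Pow {..<n}" and ?J = "\<lambda>I. {J. J \<subseteq> I \<and> P (card I) (card J)}"
  have fin: "finite (?J I)" if "I \<in> ?I" for I
    using that by (intro finite_subset[of "?J I" "Pow {..<n}"]) auto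
  \<comment> \<open>As \<open>P\<close> is an arbitrary predicate on counts, the event is bounded
    through a cover by finitely many boxes.\<close>
  have "?S \<subseteq> (\<Union>(I, J)\<in>Sigma ?I ?J. E I J)"
  proof
    fix D assume D: "D \<in> ?S"
    let ?A = "{j\<in>{..<n}. D j \<in> A}" and ?B = "{j\<in>{..<n}. D j \<in> B}"
    have "D \<in> E ?A ?B"
      using D by (auto simp: E_def space_PiM PiE_iff extensional_def)
    moreover have "(?A, ?B) \<in> Sigma ?I ?J" using D AB by auto
    ultimately show "D \<in> (\<Union>(I, J)\<in>Sigma ?I ?J. E I J)" by blast
  qed
  then have "measure ?M ?S \<le> measure ?M (\<Union>(I, J)\<in>Sigma ?I ?J. E I J)"
    using fin by (intro PM.finite_measure_mono) (auto intro!: sets.finite_UN E_sets)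
  also have "\<dots> \<le> (\<Sum>(I, J)\<in>Sigma ?I ?J. measure ?M (E I J))"
    using fin by (intro order_trans[OF PM.finite_measure_subadditive_finite])
      (auto intro!: E_sets sum_mono)
  also have "\<dots> = (\<Sum>I\<in>?I. \<Sum>J\<in>?J I. measure ?M (E I J))"
    using fin by (subst sum.Sigma) auto
  \<comment> \<open>For a fixed pattern \<open>I\<close>, the boxes have the weight
    \<open>a ^ card I * (1 - a) ^ (n - card I)\<close> of the pattern times a binomial probability
    with parameter \<open>b / a\<close>. The hypothesis bounds the latter by \<open>e\<close>, and
    the weights of all patterns sum to 1.\<close>
  also have "\<dots> \<le> (\<Sum>I\<in>?I. e * (a ^ card I * (1 - a) ^ (n - card I)))"
  proof (rule sum_mono)
    fix I assume I: "I \<in> ?I"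
    then have finI: "finite I" by (auto intro: finite_subset)
    let ?N = "card I"
    have N: "?N \<le> n" using I card_mono[of "{..<n}" I] by simp
    have cond: "b ^ j * (a - b) ^ (?N - j) = a ^ ?N * ((b / a) ^ j * (1 - b / a) ^ (?N - j))"
      if "j \<le> ?N" for j
    \<comment> \<open>If \<open>a = 0\<close> then \<open>b = 0\<close> and
      \<open>b / a = 0\<close>; both sides are 0, or both are 1 when \<open>?N = 0\<close>.\<close>
    proof (cases "a = 0")
      case True
      with ab that show ?thesis by (cases "?N = 0") (auto simp: power_0_left)
    next
      case False
      have "a ^ ?N = a ^ j * a ^ (?N - j)" using that by (simp flip: power_add)
      moreover have "a * (b / a) = b" "a * (1 - b / a) = a - b"
        using False by (auto simp: field_simps)
      then have "b ^ j * (a - b) ^ (?N - j) = (a * (b / a)) ^ j * (a * (1 - b / a)) ^ (?N - j)"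
        by simp
      then have "b ^ j * (a - b) ^ (?N - j) = a ^ j * a ^ (?N - j) * ((b / a) ^ j * (1 - b / a) ^ (?N - j))"
        by (simp only: power_mult_distrib mult_ac)
      ultimately show ?thesis by simp
    qed
    have "(\<Sum>J\<in>?J I. measure ?M (E I J)) =
        (\<Sum>J\<in>?J I. b ^ card J * (a - b) ^ (?N - card J)) * (1 - a) ^ (n - ?N)"
      using I by (auto simp: sum_distrib_right E_measure intro!: sum.cong)
    also have "(\<Sum>J\<in>?J I. b ^ card J * (a - b) ^ (?N - card J)) =
        (\<Sum>j | j \<le> ?N \<and> P ?N j. real (?N choose j) * (b ^ j * (a - b) ^ (?N - j)))"
      by (rule sum_subsets_by_card[OF finI])
    also have "\<dots> = a ^ ?N * (\<Sum>j | j \<le> ?N \<and> P ?N j. binomial_weight ?N (b / a) j)"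
      unfolding sum_distrib_left by (intro sum.cong) (auto simp: cond binomial_weight_def)
    also have "\<dots> * (1 - a) ^ (n - ?N) \<le> a ^ ?N * e * (1 - a) ^ (n - ?N)"
      using P[OF N] ab by (intro mult_right_mono mult_left_mono) (auto simp: a_def b_def)
    finally show "(\<Sum>J\<in>?J I. measure ?M (E I J)) \<le> e * (a ^ ?N * (1 - a) ^ (n - ?N))"
      by (simp add: mult_ac)
  qed
  also have "\<dots> = e * (\<Sum>I\<in>?I. a ^ card I * (1 - a) ^ (n - card I))"
    by (simp add: sum_distrib_left)
  also have "(\<Sum>I\<in>?I. a ^ card I * (1 - a) ^ (n - card I)) =
      (\<Sum>j\<le>n. real (n choose j) * (a ^ j * (1 - a) ^ (n - j)))"
    using sum_subsets_by_card[of "{..<n}" "\<lambda>j. a ^ j * (1 - a) ^ (n - j)" "\<lambda>_. True"]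
    by (simp add: Pow_def atMost_def)
  also have "\<dots> = 1"
    using binomial_ring[of a "1 - a" n] by (simp add: mult.assoc)
  finally show ?thesis by simp
qed

section \<open>Independence of the samples and Hoeffding's inequality\<close>

text \<open>The joint law of the coordinates is the product measure itself, and the law of
  coordinate \<open>i\<close> is \<open>M i\<close>, so the joint law is the product of the
  marginals.\<close>

lemma indep_vars_PiM_components:
  assumes "finite I" "I \<noteq> {}" and M: "\<And>i. i \<in> I \<Longrightarrow> prob_space (M i)"
  shows "prob_space.indep_vars (Pi\<^sub>M I M) M (\<lambda>i \<omega>. \<omega> i) I"
proof -
  interpret prob_space "Pi\<^sub>M I M" using M by (rule prob_space_PiM)
  have "distr (Pi\<^sub>M I M) (Pi\<^sub>M I M) (\<lambda>\<omega>. \<lambda>i\<in>I. \<omega> i) = distr (Pi\<^sub>M I M) (Pi\<^sub>M I M) (\<lambda>\<omega>. \<omega>)"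
    by (intro distr_cong) (auto simp: space_PiM PiE_iff extensional_restrict)
  also have "\<dots> = Pi\<^sub>M I (\<lambda>i. distr (Pi\<^sub>M I M) (M i) (\<lambda>\<omega>. \<omega> i))"
    unfolding distr_id by (intro PiM_cong) (auto simp: distr_PiM_component M)
  finally show ?thesis
    using assms by (subst indep_vars_iff_distr_eq_PiM') auto
qed

text \<open>The radius \<open>(b - a) * sqrt (- ln e / (2 * real n))\<close> is the one at which the
  one-sided Hoeffding bound equals \<open>e\<close>.\<close>

lemma hoeffding_PiM:
  fixes h :: "'a \<Rightarrow> real"
  assumes M: "prob_space M" and h: "h \<in> borel_measurable M"
    and ab: "\<And>x. x \<in> space M \<Longrightarrow> a \<le> h x \<and> h x \<le> b"
    and n: "n \<ge> 1" and e: "0 < e" "e < 1"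
  shows "measure (Pi\<^sub>M {..<n} (\<lambda>_. M)) {D \<in> space (Pi\<^sub>M {..<n} (\<lambda>_. M)).
      1 / real n * (\<Sum>j<n. h (D j)) + (b - a) * sqrt (- ln e / (2 * real n)) < (\<integral>x. h x \<partial>M)} \<le> e"
    (is "measure ?M ?S \<le> e")
proof -
  interpret M: prob_space M by fact
  interpret PM: prob_space ?M using M by (intro prob_space_PiM)
  have "a \<le> b" using ab M.not_empty by force
  then consider "a = b" | "a < b" by fastforce
  then show ?thesis
  proof cases
    \<comment> \<open>The Hoeffding exponent divides by \<open>(b - a)\<^sup>2\<close>, so a
      constant \<open>h\<close> is treated apart. The strict inequality then never holds.\<close>
    assume "a = b"
    have hc: "h x = b" if "x \<in> space M" for x
      using ab[OF that] \<open>a = b\<close> by simp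
    then have int: "(\<integral>x. h x \<partial>M) = (\<integral>x. b \<partial>M)"
      by (intro Bochner_Integration.integral_cong) auto
    have "?S = {}"
    proof -
      { fix D assume D: "D \<in> space ?M"
        then have "(\<Sum>j<n. h (D j)) = (\<Sum>j<n. b)"
          by (intro sum.cong) (auto intro!: hc simp: space_PiM)
        then have "\<not> 1 / real n * (\<Sum>j<n. h (D j)) + (b - a) * sqrt (- ln e / (2 * real n)) < (\<integral>x. h x \<partial>M)"
          using int n \<open>a = b\<close> by (simp add: M.prob_space) }
      then show ?thesis by blast
    qed
    show ?thesis unfolding \<open>?S = {}\<close> using e by simp
  next
    assume "a < b"
    let ?m = "\<integral>x. h x \<partial>M" and ?r = "(b - a) * sqrt (- ln e / (2 * real n))"
    let ?X = "\<lambda>j (D :: nat \<Rightarrow> 'a). h (D j)"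
    have E: "PM.expectation (?X j) = ?m" if "j < n" for j
    proof -
      have "?m = (\<integral>x. h x \<partial>distr ?M M (\<lambda>D. D j))"
        using that M by (subst distr_PiM_component) auto
      also have "\<dots> = PM.expectation (?X j)"
        using that h by (intro integral_distr) auto
      finally show ?thesis by simp
    qed
    have "PM.indep_vars (\<lambda>_. M) (\<lambda>j D. D j) {..<n}"
      using n M by (intro indep_vars_PiM_components) (auto simp: lessThan_empty_iff)
    then have ind: "PM.indep_vars (\<lambda>_. borel) ?X {..<n}"
      using h by (rule PM.indep_vars_compose2)
    interpret H: Hoeffding_ineq ?M "{..<n}" ?X "\<lambda>_. a" "\<lambda>_. b" "\<Sum>j<n. PM.expectation (?X j)"
    proof unfold_locales
      show "AE D in ?M. ?X j D \<in> {a..b}" if "j \<in> {..<n}" for j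
        using that ab by (intro AE_I2) (auto simp: space_PiM)
    qed (use ind in auto)
    have neg: "0 \<le> - ln e / (2 * real n)"
      using e by (intro divide_nonneg_nonneg) auto
    then have r: "0 \<le> real n * ?r"
      using \<open>a < b\<close> by (intro mult_nonneg_nonneg real_sqrt_ge_zero) auto
    have "?S \<subseteq> {D \<in> space ?M. (\<Sum>j<n. ?X j D) \<le> real n * ?m - real n * ?r}"
      using n by (auto simp: field_simps)
    also have "\<dots> = {D \<in> space ?M. (\<Sum>j<n. ?X j D) \<le> (\<Sum>j<n. PM.expectation (?X j)) - real n * ?r}"
      by (simp add: E)
    finally have "measure ?M ?S \<le> measure ?M {D \<in> space ?M. (\<Sum>j<n. ?X j D) \<le> (\<Sum>j<n. PM.expectation (?X j)) - real n * ?r}"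
      using h by (intro PM.finite_measure_mono) measurable
    also have "\<dots> \<le> exp (- 2 * (real n * ?r)\<^sup>2 / (\<Sum>j<n. (b - a)\<^sup>2))"
      using r n \<open>a < b\<close> by (intro H.Hoeffding_ineq_le) auto
    also have "- 2 * (real n * ?r)\<^sup>2 / (\<Sum>j<n. (b - a)\<^sup>2) = ln e"
    proof -
      have "(sqrt (- ln e / (2 * real n)))\<^sup>2 = - ln e / (2 * real n)"
        using neg by (rule real_sqrt_pow2)
      then have sq: "(real n * ?r)\<^sup>2 = (real n)\<^sup>2 * (b - a)\<^sup>2 * (- ln e / (2 * real n))"
        by (simp only: power_mult_distrib mult.assoc)
      have s: "(\<Sum>j<n. (b - a)\<^sup>2) = real n * (b - a)\<^sup>2" by simp
      have "- 2 * (r\<^sup>2 * d * (- l / (2 * r))) / (r * d) = l" if "r \<noteq> 0" "d \<noteq> 0" for r d l :: real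
        using that by (simp add: power2_eq_square)
      from this[of "real n" "(b - a)\<^sup>2" "ln e"] show ?thesis
        unfolding sq s using n \<open>a < b\<close> by simp
    qed
    finally show ?thesis using e by simp
  qed
qed

text \<open>By Fubini: sections over \<open>A\<close> contribute at most the measure of
  \<open>A\<close>, all others at most \<open>b\<close>. This is the device for fixing one data set
  while the remaining ones vary.\<close>

lemma prob_pair_measure_le:
  assumes M: "prob_space M" and N: "prob_space N" and S: "S \<in> sets (M \<Otimes>\<^sub>M N)"
    and A: "A \<in> sets M" "measure M A \<le> a"
    and b: "0 \<le> b" "\<And>x. x \<in> space M \<Longrightarrow> x \<notin> A \<Longrightarrow> measure N (Pair x -` S) \<le> b"
  shows "measure (M \<Otimes>\<^sub>M N) S \<le> a + b"
proof -
  interpret M: prob_space M by fact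
  interpret N: prob_space N by fact
  interpret P: pair_prob_space M N by unfold_locales
  have a: "0 \<le> a" using A(2) measure_nonneg[of M A] by linarith
  have "emeasure (M \<Otimes>\<^sub>M N) S = (\<integral>\<^sup>+x. emeasure N (Pair x -` S) \<partial>M)"
    by (rule N.emeasure_pair_measure_alt[OF S])
  also have "\<dots> \<le> (\<integral>\<^sup>+x. indicator A x + ennreal b \<partial>M)"
  proof (rule nn_integral_mono)
    fix x assume "x \<in> space M"
    then show "emeasure N (Pair x -` S) \<le> indicator A x + ennreal b"
      using b N.emeasure_le_1[of "Pair x -` S"]
      by (cases "x \<in> A") (auto simp: N.emeasure_eq_measure add_increasing2 intro: ennreal_leI order_trans)
  qed
  also have "\<dots> = emeasure M A + ennreal b"
    using A by (subst nn_integral_add) (auto simp: M.emeasure_space_1)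
  also have "\<dots> \<le> ennreal (a + b)"
    using A a b(1) by (auto simp: M.emeasure_eq_measure ennreal_plus[symmetric] simp del: ennreal_plus intro!: ennreal_leI)
  finally show ?thesis
    using a b(1) by (simp add: P.emeasure_eq_measure del: ennreal_plus)
qed

section \<open>Optimal adversaries of restricted encoders\<close>

lemma space_sample_algebra: "sets X = sets sample_algebra \<Longrightarrow> space X = UNIV"
  using sets_eq_imp_space_eq[of X sample_algebra] by (simp add: sample_algebra_def space_pair_measure)

lemma measure_cond_repr_dist_singleton:
  fixes f :: "'a::topological_space \<Rightarrow> 'b::t1_space"
  assumes X: "prob_space X" "sets X = sets sample_algebra" and f: "f \<in> borel_measurable borel"
    and q: "measure X (UNIV \<times> {s}) > 0"
  shows "measure (cond_repr_dist X f s) {c} =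
    measure X {(x, s'). f x = c \<and> s' = s} / measure X (UNIV \<times> {s})"
proof -
  interpret prob_space X by fact
  have m: "(\<lambda>(x, s). (f x, s)) \<in> X \<rightarrow>\<^sub>M sample_algebra"
    using f unfolding measurable_cong_sets[OF X(2) refl] sample_algebra_def by measurable
  interpret R: prob_space "repr_dist X f"
    unfolding repr_dist_def by (rule prob_space_distr[OF m])
  have S: "UNIV \<times> {s} \<in> sets sample_algebra" "{c} \<times> UNIV \<in> sets sample_algebra"
      "UNIV \<times> {s} \<inter> {c} \<times> UNIV \<in> sets sample_algebra"
    unfolding sample_algebra_def by auto
  have R: "measure (repr_dist X f) A = measure X ((\<lambda>(x, s). (f x, s)) -` A)"
    if "A \<in> sets sample_algebra" for A
    unfolding repr_dist_def by (simp add: measure_distr[OF m that] space_sample_algebra[OF X(2)])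
  have Rs: "measure (repr_dist X f) (UNIV \<times> {s}) = measure X (UNIV \<times> {s})"
    unfolding R[OF S(1)] by (intro arg_cong2[where f=measure]) auto
  have "measure (cond_repr_dist X f s) {c} =
      measure (uniform_measure (repr_dist X f) (UNIV \<times> {s})) ({c} \<times> UNIV)"
    unfolding cond_repr_dist_def
    by (subst measure_distr)
       (auto simp: repr_dist_def sample_algebra_def space_pair_measure intro!: arg_cong2[where f=measure])
  also have "\<dots> = measure (repr_dist X f) (UNIV \<times> {s} \<inter> {c} \<times> UNIV) / measure (repr_dist X f) (UNIV \<times> {s})"
  proof (rule measure_uniform_measure)
    show "emeasure (repr_dist X f) (UNIV \<times> {s}) \<noteq> 0"
      using q by (simp add: R.emeasure_eq_measure Rs)
  qed (use S R.emeasure_finite in \<open>auto simp: repr_dist_def\<close>)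
  also have "\<dots> = measure X {(x, s'). f x = c \<and> s' = s} / measure X (UNIV \<times> {s})"
    unfolding Rs R[OF S(3)] by (intro arg_cong2[where f="(/)"] arg_cong2[where f=measure]) auto
  finally show ?thesis .
qed

lemma AE_cond_repr_dist:
  fixes f :: "'a::topological_space \<Rightarrow> 'b::t1_space"
  assumes X: "prob_space X" "sets X = sets sample_algebra" and f: "f \<in> borel_measurable borel"
    and C: "finite C" "range f \<subseteq> C"
  shows "AE z in cond_repr_dist X f s. z \<in> C"
proof -
  have Cb: "C \<in> sets borel"
    using C(1) by (intro borel_closed finite_imp_closed)
  have m: "(\<lambda>(x, s). (f x, s)) \<in> X \<rightarrow>\<^sub>M sample_algebra"
    using f unfolding measurable_cong_sets[OF X(2) refl] sample_algebra_def by measurable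
  have "{x \<in> space sample_algebra. fst x \<in> C} \<in> sets sample_algebra"
    using Cb unfolding sample_algebra_def by measurable
  then have "AE x in repr_dist X f. fst x \<in> C"
    unfolding repr_dist_def using C(2) by (subst AE_distr_iff[OF m]) (auto simp: split_beta image_subset_iff)
  moreover have "UNIV \<times> {s} \<in> sets (repr_dist X f)"
    by (auto simp: repr_dist_def sample_algebra_def)
  ultimately have "AE x in uniform_measure (repr_dist X f) (UNIV \<times> {s}). fst x \<in> C"
    by (intro AE_uniform_measureI) auto
  moreover have "fst \<in> uniform_measure (repr_dist X f) (UNIV \<times> {s}) \<rightarrow>\<^sub>M borel"
    by (simp add: repr_dist_def sample_algebra_def)
  ultimately show ?thesis
    unfolding cond_repr_dist_def using Cb by (subst AE_distr_iff) auto
qed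

context
  fixes X :: "('a::topological_space \<times> bool) measure" and f :: "'a \<Rightarrow> 'b::t1_space"
    and C :: "'b set" and Z0 Z1 :: "'b measure"
  assumes X: "prob_space X" "sets X = sets sample_algebra" and f: "f \<in> borel_measurable borel"
    and q: "\<And>s. measure X (UNIV \<times> {s}) > 0"
    and C: "finite C" "range f \<subseteq> C"
  defines "Z0 \<equiv> cond_repr_dist X f False" and "Z1 \<equiv> cond_repr_dist X f True"
begin

private lemma integral_Z:
  assumes "h \<in> classifiers"
  shows "(\<integral>z. of_bool (h z) \<partial>cond_repr_dist X f s) = (\<Sum>z\<in>C. of_bool (h z) * measure (cond_repr_dist X f s) {z})"
    and "(\<integral>z. 1 - of_bool (h z) \<partial>cond_repr_dist X f s) =
      1 - (\<Sum>z\<in>C. of_bool (h z) * measure (cond_repr_dist X f s) {z})"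
  using integral_classifier_finite_support[OF prob_space_cond_repr_dist[OF X f q] _ C(1)
      AE_cond_repr_dist[OF X f C] assms, of s]
  by (simp_all add: cond_repr_dist_def)

lemma balanced_accuracy_sum:
  assumes "h \<in> classifiers"
  shows "2 * balanced_accuracy Z0 Z1 h =
    1 + (\<Sum>z\<in>C. of_bool (h z) * (measure Z1 {z} - measure Z0 {z}))"
  unfolding balanced_accuracy_def Z0_def Z1_def integral_Z[OF assms]
  by (simp add: right_diff_distrib sum_subtractf)

text \<open>All optimal adversaries have the same balanced accuracy, so it may be computed from the
  explicit one. That one gains \<open>max (measure Z0 {z}) (measure Z1 {z}) - measure Z0 {z}\<close>
  at each \<open>z\<close>.\<close>

lemma balanced_accuracy_optimal:
  assumes h: "optimal_adversary Z0 Z1 h"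
  shows "2 * balanced_accuracy Z0 Z1 h = (\<Sum>z\<in>C. max (measure Z0 {z}) (measure Z1 {z}))"
proof -
  let ?e = "\<lambda>z. measure Z1 {z} \<ge> measure Z0 {z}"
  have "optimal_adversary Z0 Z1 ?e"
    unfolding Z0_def Z1_def by (rule optimal_adversary_explicit[OF X f finite_subset[OF C(2,1)] q])
  with h have hc: "h \<in> classifiers" "?e \<in> classifiers"
      and eq: "balanced_accuracy Z0 Z1 h = balanced_accuracy Z0 Z1 ?e"
    unfolding optimal_adversary_def by (auto intro: antisym)
  \<comment> \<open>Integrating the constant classifier shows that the point masses on
    \<open>C\<close> sum to 1, which cancels the constant in
    \<open>balanced_accuracy_sum\<close>.\<close>
  have "(\<lambda>_. True) \<in> (classifiers :: ('b \<Rightarrow> bool) set)"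
    by (simp add: classifiers_def)
  from integral_Z(1)[OF this, of False]
  have "(\<Sum>z\<in>C. measure Z0 {z}) = 1"
    using prob_space.prob_space[OF prob_space_cond_repr_dist[OF X f q]] by (simp add: Z0_def)
  moreover have "(\<Sum>z\<in>C. of_bool (?e z) * (measure Z1 {z} - measure Z0 {z})) =
      (\<Sum>z\<in>C. max (measure Z0 {z}) (measure Z1 {z}) - measure Z0 {z})"
    by (intro sum.cong) auto
  ultimately show ?thesis
    unfolding eq balanced_accuracy_sum[OF hc(2)] by (simp add: sum_subtractf)
qed

text \<open>Read as adversaries, \<open>g\<close> and its negation yield the two signs of the
  difference under the absolute value.\<close>

lemma dp_distance_le_balanced_accuracy_optimal:
  assumes h: "optimal_adversary Z0 Z1 h" and g: "g \<in> classifiers"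
  shows "dp_distance Z0 Z1 g \<le> 2 * balanced_accuracy Z0 Z1 h - 1"
proof -
  have ng: "(\<lambda>z. \<not> g z) \<in> classifiers"
    using g unfolding classifiers_def by measurable
  have "balanced_accuracy Z0 Z1 g \<le> balanced_accuracy Z0 Z1 h"
      "balanced_accuracy Z0 Z1 (\<lambda>z. \<not> g z) \<le> balanced_accuracy Z0 Z1 h"
    using h g ng by (auto simp: optimal_adversary_def)
  moreover have "2 * balanced_accuracy Z0 Z1 g - 1 = (\<integral>z. of_bool (g z) \<partial>Z1) - (\<integral>z. of_bool (g z) \<partial>Z0)"
    unfolding balanced_accuracy_def Z0_def Z1_def integral_Z[OF g] by (simp add: field_simps)
  moreover have "2 * balanced_accuracy Z0 Z1 (\<lambda>z. \<not> g z) - 1 =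
      (\<integral>z. of_bool (g z) \<partial>Z0) - (\<integral>z. of_bool (g z) \<partial>Z1)"
    unfolding balanced_accuracy_def Z0_def Z1_def
    using integral_Z[OF g, of False] integral_Z[OF g, of True] by (simp add: of_bool_not_iff add_divide_distrib diff_divide_distrib)
  ultimately show ?thesis by (simp add: dp_distance_def)
qed

text \<open>Ensures that a statement about all optimal adversaries is not vacuous, so that a bound
  on the optimal accuracy can be recovered from it.\<close>

lemma ex_optimal_adversary: "\<exists>h. optimal_adversary Z0 Z1 h"
  unfolding Z0_def Z1_def
  using optimal_adversary_explicit[OF X f finite_subset[OF C(2,1)] q] by blast

end

section \<open>Measurability of the bound\<close>

definition cell_prob :: "('a \<times> bool) measure \<Rightarrow> ('a \<Rightarrow> 'b) \<Rightarrow> 'b \<Rightarrow> bool \<Rightarrow> real" where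
  "cell_prob X f c s = measure X {(x, s'). f x = c \<and> s' = s}"

text \<open>Closed form of the balanced accuracy of any optimal adversary. It mentions no adversary,
  so its dependence on the training data can be seen to be measurable.\<close>

definition optimal_accuracy ::
    "('a \<times> bool) measure \<Rightarrow> ('a \<Rightarrow> 'b) \<Rightarrow> (nat \<Rightarrow> 'b) \<Rightarrow> nat \<Rightarrow> real" where
  "optimal_accuracy X f z k = 1 / 2 * (\<Sum>i\<in>{1..k}.
     max (cell_prob X f (z i) False / measure X (UNIV \<times> {False}))
         (cell_prob X f (z i) True / measure X (UNIV \<times> {True})))"

text \<open>Real-valued counterpart of \<open>cell_bound\<close> for finite factors, with
  \<open>e\<close> in place of \<open>eps_c / (2 * k)\<close>, so that integration and Hoeffding's
  inequality apply.\<close>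

definition real_cell_bound :: "real \<Rightarrow> real \<Rightarrow> real \<Rightarrow> nat \<Rightarrow> nat \<Rightarrow> real" where
  "real_cell_bound A0 A1 e n m =
     max (A0 * beta_quantile (1 - e) (real m + 1) (real n - real m))
         (A1 * (1 - beta_quantile e (real m) (real n - real m + 1)))"

lemma cell_bound_ereal:
  "cell_bound (ereal A0) (ereal A1) e k n m = ereal (real_cell_bound A0 A1 (e / (2 * real k)) n m)"
  by (simp add: cell_bound_def real_cell_bound_def)

lemma S_star_real:
  fixes f :: "'a \<Rightarrow> 'b" and z :: "nat \<Rightarrow> 'b" and Dval :: "'a dataset"
    and eps_c :: real and nval :: nat
  assumes "alpha0 eps_b ntr (count_s0 ntr Dtr) = ereal A0"
    and "alpha1 eps_b ntr (count_s0 ntr Dtr) = ereal A1" and k: "k \<ge> 1"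
  defines "t \<equiv> \<lambda>i. real_cell_bound A0 A1 (eps_c / (2 * real k))
      (count_cell nval f (z i) Dval) (count_cell_s0 nval f (z i) Dval)"
  shows "S_star eps_b eps_c eps_s k ntr nval nte f z Dtr Dval Dte =
    ereal (1 / real nte * (\<Sum>j<nte. t (the_inv_into {1..k} z (f (fst (Dte j)))))
      + (Max (t ` {1..k}) - Min (t ` {1..k})) * sqrt (- ln eps_s / (2 * real nte)))"
proof -
  have m: "mono ereal" by (auto simp: mono_def)
  have ne: "t ` {1..k} \<noteq> {}" "finite (t ` {1..k})" using k by auto
  have "Min ((\<lambda>i. ereal (t i)) ` {1..k}) = ereal (Min (t ` {1..k}))"
    using mono_Min_commute[OF m ne(2,1)] by (simp add: image_image)
  moreover have "Max ((\<lambda>i. ereal (t i)) ` {1..k}) = ereal (Max (t ` {1..k}))"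
    using mono_Max_commute[OF m ne(2,1)] by (simp add: image_image)
  ultimately show ?thesis
    unfolding S_star_def Let_def assms(1,2) cell_bound_ereal
    by (simp add: t_def)
qed

lemma T_star_infinite:
  assumes "alpha0 eps_b ntr (count_s0 ntr Dtr) = \<infinity> \<or> alpha1 eps_b ntr (count_s0 ntr Dtr) = \<infinity>"
  shows "T_star eps_b eps_c eps_s k ntr nval nte f z Dtr Dval Dte = \<infinity>"
proof -
  have "S_star eps_b eps_c eps_s k ntr nval nte f z Dtr Dval Dte = \<infinity>"
    using assms by (simp add: S_star_def Let_def)
  then show ?thesis by (simp add: T_star_def one_ereal_def)
qed

text \<open>Stated along arbitrary measurable \<open>D1\<close> and \<open>D2\<close>, so that it
  serves both the triple of data sets and, with a constant \<open>D1\<close>, a fixed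
  encoder.\<close>

lemma measurable_count_cell:
  fixes f :: "'c \<Rightarrow> 'a::topological_space \<Rightarrow> 'b::{second_countable_topology, t2_space}"
  assumes X: "sets X = sets sample_algebra"
    and f: "(\<lambda>(D, x). f D x) \<in> M \<Otimes>\<^sub>M borel \<rightarrow>\<^sub>M borel"
    and z: "z \<in> M \<rightarrow>\<^sub>M borel"
    and D1: "D1 \<in> N \<rightarrow>\<^sub>M M" and D2: "D2 \<in> N \<rightarrow>\<^sub>M dataset_dist n X"
  shows "(\<lambda>\<omega>. count_cell n (f (D1 \<omega>)) (z (D1 \<omega>)) (D2 \<omega>)) \<in> N \<rightarrow>\<^sub>M count_space UNIV"
    and "(\<lambda>\<omega>. count_cell_s0 n (f (D1 \<omega>)) (z (D1 \<omega>)) (D2 \<omega>)) \<in> N \<rightarrow>\<^sub>M count_space UNIV"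
proof -
  have fz: "Measurable.pred N (\<lambda>\<omega>. f (D1 \<omega>) (fst (D2 \<omega> j)) = z (D1 \<omega>))"
    and s: "Measurable.pred N (\<lambda>\<omega>. snd (D2 \<omega> j))" if "j < n" for j
  proof -
    have c: "(\<lambda>\<omega>. D2 \<omega> j) \<in> N \<rightarrow>\<^sub>M borel \<Otimes>\<^sub>M count_space UNIV"
      using measurable_compose[OF D2[unfolded dataset_dist_def] measurable_component_singleton[of j]] that
      by (simp add: measurable_cong_sets[OF refl X] sample_algebra_def)
    have "(\<lambda>\<omega>. (D1 \<omega>, fst (D2 \<omega> j))) \<in> N \<rightarrow>\<^sub>M M \<Otimes>\<^sub>M borel"
      using D1 measurable_compose[OF c measurable_fst] by (intro measurable_Pair) auto
    from measurable_compose[OF this f]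
    have [measurable]: "(\<lambda>\<omega>. f (D1 \<omega>) (fst (D2 \<omega> j))) \<in> N \<rightarrow>\<^sub>M borel" by simp
    have [measurable]: "(\<lambda>\<omega>. z (D1 \<omega>)) \<in> N \<rightarrow>\<^sub>M borel"
      by (rule measurable_compose[OF D1 z])
    show "Measurable.pred N (\<lambda>\<omega>. f (D1 \<omega>) (fst (D2 \<omega> j)) = z (D1 \<omega>))" by measurable
    show "Measurable.pred N (\<lambda>\<omega>. snd (D2 \<omega> j))"
      by (rule measurable_compose[OF c measurable_snd])
  qed
  show "(\<lambda>\<omega>. count_cell n (f (D1 \<omega>)) (z (D1 \<omega>)) (D2 \<omega>)) \<in> N \<rightarrow>\<^sub>M count_space UNIV"
    unfolding count_cell_def
  proof (rule measurable_card)
    fix j show "{\<omega> \<in> space N. j \<in> {j \<in> {..<n}. f (D1 \<omega>) (fst (D2 \<omega> j)) = z (D1 \<omega>)}} \<in> sets N"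
      using fz[of j] by (cases "j < n") (auto simp: pred_def)
  qed
  show "(\<lambda>\<omega>. count_cell_s0 n (f (D1 \<omega>)) (z (D1 \<omega>)) (D2 \<omega>)) \<in> N \<rightarrow>\<^sub>M count_space UNIV"
    unfolding count_cell_s0_def
  proof (rule measurable_card)
    fix j show "{\<omega> \<in> space N. j \<in> {j \<in> {..<n}. f (D1 \<omega>) (fst (D2 \<omega> j)) = z (D1 \<omega>) \<and> \<not> snd (D2 \<omega> j)}} \<in> sets N"
    proof (cases "j < n")
      case True
      note [measurable] = fz[OF True] s[OF True]
      have "Measurable.pred N (\<lambda>\<omega>. f (D1 \<omega>) (fst (D2 \<omega> j)) = z (D1 \<omega>) \<and> \<not> snd (D2 \<omega> j))"
        by measurable
      with True show ?thesis by (simp add: pred_def)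
    qed simp
  qed
qed

lemma measurable_count_s0:
  fixes X :: "('a::topological_space \<times> bool) measure"
  assumes X: "sets X = sets sample_algebra"
  shows "count_s0 n \<in> dataset_dist n X \<rightarrow>\<^sub>M count_space UNIV"
proof -
  have "(\<lambda>D. card {j \<in> {..<n}. \<not> snd (D j)}) \<in> dataset_dist n X \<rightarrow>\<^sub>M count_space UNIV"
  proof (rule measurable_card)
    fix j show "{D \<in> space (dataset_dist n X). j \<in> {j \<in> {..<n}. \<not> snd (D j)}} \<in> sets (dataset_dist n X)"
    proof (cases "j < n")
      case True
      then have "(\<lambda>D. D j) \<in> dataset_dist n X \<rightarrow>\<^sub>M borel \<Otimes>\<^sub>M count_space UNIV"
        using measurable_component_singleton[of j "{..<n}" "\<lambda>_. X"]
        by (simp add: dataset_dist_def measurable_cong_sets[OF refl X] sample_algebra_def)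
      from measurable_compose[OF this measurable_snd]
      have [measurable]: "Measurable.pred (dataset_dist n X) (\<lambda>D. snd (D j))" .
      have "Measurable.pred (dataset_dist n X) (\<lambda>D. \<not> snd (D j))" by measurable
      with True show ?thesis by (simp add: pred_def)
    qed simp
  qed
  then show ?thesis unfolding count_s0_def[abs_def] .
qed

text \<open>Counts take countably many values, so \<open>F\<close> may be arbitrary. In particular,
  Beta quantiles enter only as a table indexed by counts.\<close>

lemma measurable_nat3:
  fixes F :: "nat \<Rightarrow> nat \<Rightarrow> nat \<Rightarrow> 'a::topological_space"
  assumes "u \<in> N \<rightarrow>\<^sub>M count_space UNIV" "v \<in> N \<rightarrow>\<^sub>M count_space UNIV" "w \<in> N \<rightarrow>\<^sub>M count_space UNIV"
  shows "(\<lambda>\<omega>. F (u \<omega>) (v \<omega>) (w \<omega>)) \<in> N \<rightarrow>\<^sub>M borel"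
proof (rule measurable_compose_countable[OF _ assms(1)])
  show "(\<lambda>\<omega>. F a (v \<omega>) (w \<omega>)) \<in> N \<rightarrow>\<^sub>M borel" for a
  proof (rule measurable_compose_countable[OF _ assms(2)])
    show "(\<lambda>\<omega>. F a b (w \<omega>)) \<in> N \<rightarrow>\<^sub>M borel" for b
      by (rule measurable_compose[OF assms(3)]) simp
  qed
qed

text \<open>The obstacle is the cell index, an inverse of \<open>z\<close> that varies with the
  training data. A finite sum over the cells replaces it.\<close>

lemma measurable_T_star:
  fixes f :: "'a::topological_space dataset \<Rightarrow> 'a \<Rightarrow> 'b::{second_countable_topology, t2_space}"
    and X :: "('a \<times> bool) measure"
  assumes X: "sets X = sets sample_algebra" and k: "k \<ge> 1"
    and f: "(\<lambda>(D, x). f D x) \<in> dataset_dist ntr X \<Otimes>\<^sub>M borel \<rightarrow>\<^sub>M borel"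
    and z: "\<And>i. i \<in> {1..k} \<Longrightarrow> (\<lambda>D. z D i) \<in> dataset_dist ntr X \<rightarrow>\<^sub>M borel"
    and inj: "\<And>D. D \<in> space (dataset_dist ntr X) \<Longrightarrow> inj_on (z D) {1..k}"
    and cells: "\<And>D x. D \<in> space (dataset_dist ntr X) \<Longrightarrow> f D x \<in> z D ` {1..k}"
  shows "(\<lambda>(Dtr, Dval, Dte). T_star eps_b eps_c eps_s k ntr nval nte (f Dtr) (z Dtr) Dtr Dval Dte)
    \<in> dataset_dist ntr X \<Otimes>\<^sub>M dataset_dist nval X \<Otimes>\<^sub>M dataset_dist nte X \<rightarrow>\<^sub>M borel"
proof -
  let ?P = "dataset_dist ntr X \<Otimes>\<^sub>M dataset_dist nval X \<Otimes>\<^sub>M dataset_dist nte X"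
  define t where "t i \<omega> = cell_bound (alpha0 eps_b ntr (count_s0 ntr (fst \<omega>))) (alpha1 eps_b ntr (count_s0 ntr (fst \<omega>)))
      eps_c k (count_cell nval (f (fst \<omega>)) (z (fst \<omega>) i) (fst (snd \<omega>)))
      (count_cell_s0 nval (f (fst \<omega>)) (z (fst \<omega>) i) (fst (snd \<omega>)))"
    for i and \<omega> :: "'a dataset \<times> 'a dataset \<times> 'a dataset"
  have D: "fst \<in> ?P \<rightarrow>\<^sub>M dataset_dist ntr X" "(\<lambda>\<omega>. fst (snd \<omega>)) \<in> ?P \<rightarrow>\<^sub>M dataset_dist nval X"
      "(\<lambda>\<omega>. snd (snd \<omega>)) \<in> ?P \<rightarrow>\<^sub>M dataset_dist nte X"
    by measurable
  have m: "(\<lambda>\<omega>. count_s0 ntr (fst \<omega>)) \<in> ?P \<rightarrow>\<^sub>M count_space UNIV"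
    by (rule measurable_compose[OF D(1) measurable_count_s0[OF X]])
  have t[measurable]: "t i \<in> borel_measurable ?P" if "i \<in> {1..k}" for i
    unfolding t_def
    by (rule measurable_nat3[OF m measurable_count_cell[OF X f z[OF that] D(1,2)],
          of "\<lambda>m. cell_bound (alpha0 eps_b ntr m) (alpha1 eps_b ntr m) eps_c k"])
  \<comment> \<open>Exactly one cell matches since \<open>z\<close> is injective, so the sum selects
    the right \<open>t i\<close> using only equality tests between measurable maps.\<close>
  have eq: "t (the_inv_into {1..k} (z (fst \<omega>)) (f (fst \<omega>) (fst (snd (snd \<omega>) j)))) \<omega> =
      (\<Sum>i\<in>{1..k}. if f (fst \<omega>) (fst (snd (snd \<omega>) j)) = z (fst \<omega>) i then t i \<omega> else 0)"
    if "\<omega> \<in> space ?P" for \<omega> j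
  proof -
    have sp: "fst \<omega> \<in> space (dataset_dist ntr X)"
      using that by (auto simp: space_pair_measure)
    obtain i where i: "i \<in> {1..k}" "f (fst \<omega>) (fst (snd (snd \<omega>) j)) = z (fst \<omega>) i"
      using cells[OF sp] by blast
    have "(\<Sum>l\<in>{1..k}. if f (fst \<omega>) (fst (snd (snd \<omega>) j)) = z (fst \<omega>) l then t l \<omega> else 0) =
        (\<Sum>l\<in>{1..k}. if i = l then t l \<omega> else 0)"
      unfolding i(2) using i(1) inj_on_eq_iff[OF inj[OF sp]] by (intro sum.cong) auto
    then show ?thesis
      unfolding i(2) the_inv_into_f_f[OF inj[OF sp] i(1)] using i(1) by simp
  qed
  have ind[measurable]: "Measurable.pred ?P (\<lambda>\<omega>. f (fst \<omega>) (fst (snd (snd \<omega>) j)) = z (fst \<omega>) i)"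
    if "j < nte" "i \<in> {1..k}" for i j
  proof -
    have c: "(\<lambda>\<omega>. snd (snd \<omega>) j) \<in> ?P \<rightarrow>\<^sub>M borel \<Otimes>\<^sub>M count_space UNIV"
      using measurable_compose[OF D(3)[unfolded dataset_dist_def] measurable_component_singleton[of j]] that
      by (simp add: measurable_cong_sets[OF refl X] sample_algebra_def dataset_dist_def)
    have "(\<lambda>\<omega>. (fst \<omega>, fst (snd (snd \<omega>) j))) \<in> ?P \<rightarrow>\<^sub>M dataset_dist ntr X \<Otimes>\<^sub>M borel"
      using D(1) measurable_compose[OF c measurable_fst] by (intro measurable_Pair) auto
    from measurable_compose[OF this f]
    have [measurable]: "(\<lambda>\<omega>. f (fst \<omega>) (fst (snd (snd \<omega>) j))) \<in> ?P \<rightarrow>\<^sub>M borel" by simp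
    have [measurable]: "(\<lambda>\<omega>. z (fst \<omega>) i) \<in> ?P \<rightarrow>\<^sub>M borel"
      by (rule measurable_compose[OF D(1) z[OF that(2)]])
    show ?thesis by measurable
  qed
  have S: "(\<lambda>\<omega>. ereal (1 / real nte) *
      (\<Sum>j<nte. \<Sum>i\<in>{1..k}. if f (fst \<omega>) (fst (snd (snd \<omega>) j)) = z (fst \<omega>) i then t i \<omega> else 0)
      + (Max ((\<lambda>i. t i \<omega>) ` {1..k}) - Min ((\<lambda>i. t i \<omega>) ` {1..k})) * ereal (sqrt (- ln eps_s / (2 * real nte))))
      \<in> borel_measurable ?P"
  proof (intro borel_measurable_ereal_add borel_measurable_ereal_times borel_measurable_const)
    show "(\<lambda>\<omega>. \<Sum>j<nte. \<Sum>i\<in>{1..k}. if f (fst \<omega>) (fst (snd (snd \<omega>) j)) = z (fst \<omega>) i then t i \<omega> else 0)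
        \<in> borel_measurable ?P"
    proof (intro borel_measurable_ereal_sum)
      fix j i assume "j \<in> {..<nte}" "i \<in> {1..k}"
      then show "(\<lambda>\<omega>. if f (fst \<omega>) (fst (snd (snd \<omega>) j)) = z (fst \<omega>) i then t i \<omega> else 0) \<in> borel_measurable ?P"
        using ind[of j i] t[of i] by (intro measurable_If) (auto simp: pred_def)
    qed
    show "(\<lambda>\<omega>. Max ((\<lambda>i. t i \<omega>) ` {1..k}) - Min ((\<lambda>i. t i \<omega>) ` {1..k})) \<in> borel_measurable ?P"
      by (rule borel_measurable_ereal_diff[OF borel_measurable_Max[OF finite_atLeastAtMost t]
            borel_measurable_Min[OF finite_atLeastAtMost t]])
  qed
  have A: "Measurable.pred ?P (\<lambda>\<omega>. alpha0 eps_b ntr (count_s0 ntr (fst \<omega>)) = \<infinity> \<or> alpha1 eps_b ntr (count_s0 ntr (fst \<omega>)) = \<infinity>)"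
    by (rule measurable_compose[OF m,
          of "\<lambda>m. alpha0 eps_b ntr m = \<infinity> \<or> alpha1 eps_b ntr m = \<infinity>" "count_space UNIV"]) simp
  have "(\<lambda>\<omega>. T_star eps_b eps_c eps_s k ntr nval nte (f (fst \<omega>)) (z (fst \<omega>)) (fst \<omega>) (fst (snd \<omega>)) (snd (snd \<omega>)))
      \<in> borel_measurable ?P"
  proof (subst measurable_cong)
    fix \<omega> assume \<omega>: "\<omega> \<in> space ?P"
    show "T_star eps_b eps_c eps_s k ntr nval nte (f (fst \<omega>)) (z (fst \<omega>)) (fst \<omega>) (fst (snd \<omega>)) (snd (snd \<omega>)) =
      2 * (if alpha0 eps_b ntr (count_s0 ntr (fst \<omega>)) = \<infinity> \<or> alpha1 eps_b ntr (count_s0 ntr (fst \<omega>)) = \<infinity> then \<infinity>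
        else ereal (1 / real nte) *
      (\<Sum>j<nte. \<Sum>i\<in>{1..k}. if f (fst \<omega>) (fst (snd (snd \<omega>) j)) = z (fst \<omega>) i then t i \<omega> else 0)
      + (Max ((\<lambda>i. t i \<omega>) ` {1..k}) - Min ((\<lambda>i. t i \<omega>) ` {1..k})) * ereal (sqrt (- ln eps_s / (2 * real nte)))) - 1"
      unfolding T_star_def S_star_def Let_def eq[OF \<omega>, symmetric] unfolding t_def by (rule refl)
  next
    show "(\<lambda>\<omega>. 2 * (if alpha0 eps_b ntr (count_s0 ntr (fst \<omega>)) = \<infinity> \<or> alpha1 eps_b ntr (count_s0 ntr (fst \<omega>)) = \<infinity> then \<infinity>
        else ereal (1 / real nte) *
      (\<Sum>j<nte. \<Sum>i\<in>{1..k}. if f (fst \<omega>) (fst (snd (snd \<omega>) j)) = z (fst \<omega>) i then t i \<omega> else 0)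
      + (Max ((\<lambda>i. t i \<omega>) ` {1..k}) - Min ((\<lambda>i. t i \<omega>) ` {1..k})) * ereal (sqrt (- ln eps_s / (2 * real nte)))) - 1)
      \<in> borel_measurable ?P"
      using A[unfolded pred_def]
      by (rule borel_measurable_ereal_diff[OF borel_measurable_ereal_times[OF borel_measurable_const
            measurable_If[OF borel_measurable_const S]] borel_measurable_const])
  qed
  then show ?thesis by (simp add: split_beta')
qed

lemma measurable_optimal_accuracy:
  fixes f :: "'c \<Rightarrow> 'a::topological_space \<Rightarrow> 'b::{second_countable_topology, t2_space}"
    and X :: "('a \<times> bool) measure"
  assumes X: "prob_space X" "sets X = sets sample_algebra"
    and f: "(\<lambda>(D, x). f D x) \<in> M \<Otimes>\<^sub>M borel \<rightarrow>\<^sub>M borel"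
    and z: "\<And>i. i \<in> {1..k} \<Longrightarrow> (\<lambda>D. z D i) \<in> M \<rightarrow>\<^sub>M borel"
  shows "(\<lambda>D. optimal_accuracy X (f D) (z D) k) \<in> borel_measurable M"
proof -
  interpret prob_space X by fact
  have [measurable]: "(\<lambda>D. cell_prob X (f D) (z D i) s) \<in> borel_measurable M" if "i \<in> {1..k}" for i s
  proof -
    \<comment> \<open>A cell probability is the measure of the section of \<open>?Q\<close> at the
      training data, hence measurable as in Fubini's theorem.\<close>
    let ?Q = "{\<omega> \<in> space (M \<Otimes>\<^sub>M X). f (fst \<omega>) (fst (snd \<omega>)) = z (fst \<omega>) i \<and> snd (snd \<omega>) = s}"
    have sn: "snd \<in> M \<Otimes>\<^sub>M X \<rightarrow>\<^sub>M borel \<Otimes>\<^sub>M count_space UNIV"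
      using measurable_snd[of M X] by (simp add: measurable_cong_sets[OF refl X(2)] sample_algebra_def)
    have "(\<lambda>\<omega>. (fst \<omega>, fst (snd \<omega>))) \<in> M \<Otimes>\<^sub>M X \<rightarrow>\<^sub>M M \<Otimes>\<^sub>M borel"
      using measurable_compose[OF sn measurable_fst] by (intro measurable_Pair) auto
    from measurable_compose[OF this f]
    have [measurable]: "(\<lambda>\<omega>. f (fst \<omega>) (fst (snd \<omega>))) \<in> M \<Otimes>\<^sub>M X \<rightarrow>\<^sub>M borel" by simp
    have [measurable]: "(\<lambda>\<omega>. z (fst \<omega>) i) \<in> M \<Otimes>\<^sub>M X \<rightarrow>\<^sub>M borel"
      by (rule measurable_compose[OF measurable_fst z[OF that]])
    have [measurable]: "(\<lambda>\<omega>. snd (snd \<omega>)) \<in> M \<Otimes>\<^sub>M X \<rightarrow>\<^sub>M count_space UNIV"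
      by (rule measurable_compose[OF sn measurable_snd])
    have "?Q \<in> sets (M \<Otimes>\<^sub>M X)" by measurable
    from measurable_emeasure_Pair[OF this]
    have "(\<lambda>D. measure X (Pair D -` ?Q)) \<in> borel_measurable M"
      unfolding measure_def by (rule borel_measurable_enn2real)
    moreover have "measure X (Pair D -` ?Q) = cell_prob X (f D) (z D i) s" if "D \<in> space M" for D
      unfolding cell_prob_def using that
      by (intro arg_cong2[where f=measure]) (auto simp: space_pair_measure space_sample_algebra[OF X(2)])
    ultimately show ?thesis by (subst measurable_cong) (auto simp: eq_commute)
  qed
  show ?thesis unfolding optimal_accuracy_def by measurable
qed

section \<open>Coverage and the failure probability\<close>

text \<open>Given the number of samples in \<open>A\<close>, the number in \<open>B\<close> is
  binomial with parameter \<open>q\<close>; missing \<open>q\<close> from above and from below costs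
  \<open>e\<close> each.\<close>

lemma clopper_pearson_coverage:
  fixes n :: nat
  assumes M: "prob_space M" and AB: "A \<in> sets M" "B \<in> sets M" "B \<subseteq> A" and e: "0 < e" "e < 1"
  defines "q \<equiv> measure M B / measure M A"
  shows "measure (Pi\<^sub>M {..<n} (\<lambda>_. M)) {D \<in> space (Pi\<^sub>M {..<n} (\<lambda>_. M)).
      \<not> (let N = card {j\<in>{..<n}. D j \<in> A}; m = card {j\<in>{..<n}. D j \<in> B} in
        beta_quantile e (real m) (real N - real m + 1) \<le> q \<and>
        q \<le> beta_quantile (1 - e) (real m + 1) (real N - real m))} \<le> 2 * e"
proof -
  interpret prob_space M by fact
  have q: "0 \<le> q" "q \<le> 1"
    using AB finite_measure_mono[of B A] by (auto simp: q_def divide_le_eq_1 zero_less_measure_iff)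
  let ?P = "\<lambda>N m. \<not> (beta_quantile e (real m) (real N - real m + 1) \<le> q \<and>
    q \<le> beta_quantile (1 - e) (real m + 1) (real N - real m))"
  have sum_le: "(\<Sum>j | j \<le> N \<and> ?P N j. binomial_weight N q j) \<le> 2 * e" for N
  proof -
    let ?l = "{j. j \<le> N \<and> q < beta_quantile e (real j) (real N - real j + 1)}"
    let ?u = "{j. j \<le> N \<and> beta_quantile (1 - e) (real j + 1) (real N - real j) < q}"
    have "(\<Sum>j | j \<le> N \<and> ?P N j. binomial_weight N q j) = sum (binomial_weight N q) (?l \<union> ?u)"
      by (intro sum.cong) auto
    also have "\<dots> \<le> sum (binomial_weight N q) ?l + sum (binomial_weight N q) ?u"
      using q by (simp add: sum_Un sum_nonneg binomial_weight_nonneg)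
    also have "\<dots> \<le> e + e"
      by (intro add_mono clopper_pearson_lower clopper_pearson_upper q e)
    finally show ?thesis by simp
  qed
  show ?thesis
    unfolding Let_def by (rule prob_counts_le[OF M AB, of n ?P, folded q_def]) (rule sum_le)
qed

lemma UNIV_times_in_sample_algebra: "UNIV \<times> {s} \<in> sets (sample_algebra :: ('a::topological_space \<times> bool) measure)"
  by (auto simp: sample_algebra_def)

lemma count_s0_le: "count_s0 n D \<le> n"
  unfolding count_s0_def by (rule order_trans[OF card_mono[of "{..<n}"]]) auto

text \<open>The case where \<open>A\<close> is the whole space: all \<open>n\<close> samples count
  and the quotient is \<open>P (s = 0)\<close>.\<close>

lemma class_prob_coverage:
  fixes X :: "('a::topological_space \<times> bool) measure"
  assumes X: "prob_space X" "sets X = sets sample_algebra" and e: "0 < e" "e < 1"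
  defines "q \<equiv> measure X (UNIV \<times> {False})"
  shows "measure (dataset_dist n X) {D \<in> space (dataset_dist n X).
      \<not> (beta_quantile e (real (count_s0 n D)) (real n - real (count_s0 n D) + 1) \<le> q \<and>
        q \<le> beta_quantile (1 - e) (real (count_s0 n D) + 1) (real n - real (count_s0 n D)))} \<le> 2 * e"
proof -
  interpret prob_space X by fact
  have "measure X UNIV = 1"
    using prob_space by (simp add: space_sample_algebra[OF X(2)])
  moreover have "{j\<in>{..<n}. D j \<in> UNIV \<times> {False}} = {j\<in>{..<n}. \<not> snd (D j)}" for D :: "'a dataset"
    by (auto simp: mem_Times_iff)
  moreover have "UNIV \<in> sets X"
    using sets.top[of X] by (simp add: space_sample_algebra[OF X(2)])
  ultimately show ?thesis
    using clopper_pearson_coverage[OF X(1) _ _ _ e, of UNIV "UNIV \<times> {False}" n] X(2)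
    by (simp add: Let_def dataset_dist_def q_def count_s0_def UNIV_times_in_sample_algebra)
qed

section \<open>A fixed encoder: coverage, optimal accuracy and failure probability\<close>

context
  fixes X :: "('a::topological_space \<times> bool) measure" and f :: "'a \<Rightarrow> 'b::{second_countable_topology, t2_space}"
    and z :: "nat \<Rightarrow> 'b" and k :: nat
  assumes X: "prob_space X" "sets X = sets sample_algebra" and f: "f \<in> borel_measurable borel"
    and q: "\<And>s. measure X (UNIV \<times> {s}) > 0"
    and k: "k \<ge> 1" and inj: "inj_on z {1..k}" and cells: "range f \<subseteq> z ` {1..k}"
begin

interpretation prob_space X by (rule X(1))

lemma cell_sets: "{(x, s'). f x = c \<and> s' = s} \<in> sets X" "{(x, s'). f x = c} \<in> sets X"
proof -
  have "f -` {c} \<in> sets borel"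
    using measurable_sets[OF f, of "{c}"] by simp
  moreover have "{(x, s'). f x = c \<and> s' = s} = (f -` {c}) \<times> {s}" "{(x, s'). f x = c} = (f -` {c}) \<times> (UNIV :: bool set)"
    by auto
  ultimately show "{(x, s'). f x = c \<and> s' = s} \<in> sets X" "{(x, s'). f x = c} \<in> sets X"
    unfolding X(2) sample_algebra_def by auto
qed

lemma measure_cell: "measure X {(x, s'). f x = c} = cell_prob X f c False + cell_prob X f c True"
proof -
  have "{(x, s'). f x = c} = {(x, s'). f x = c \<and> s' = False} \<union> {(x, s'). f x = c \<and> s' = True}"
    by auto
  then show ?thesis
    unfolding cell_prob_def using finite_measure_Union[OF cell_sets(1)[of c False] cell_sets(1)[of c True]]
    by (auto simp only:)
qed

lemma cell_coverage:
  fixes c :: 'b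
  assumes e: "0 < e" "e < 1"
  defines "r \<equiv> cell_prob X f c False / (cell_prob X f c False + cell_prob X f c True)"
  shows "measure (dataset_dist n X) {D \<in> space (dataset_dist n X).
      \<not> (beta_quantile e (real (count_cell_s0 n f c D)) (real (count_cell n f c D) - real (count_cell_s0 n f c D) + 1) \<le> r \<and>
        r \<le> beta_quantile (1 - e) (real (count_cell_s0 n f c D) + 1) (real (count_cell n f c D) - real (count_cell_s0 n f c D)))}
    \<le> 2 * e"
proof -
  have "{(x, s'). f x = c \<and> s' = False} \<subseteq> {(x, s'). f x = c}" by auto
  moreover have "{j\<in>{..<n}. D j \<in> {(x, s'). f x = c \<and> s' = False}} = {j\<in>{..<n}. f (fst (D j)) = c \<and> \<not> snd (D j)}"
      "{j\<in>{..<n}. D j \<in> {(x, s'). f x = c}} = {j\<in>{..<n}. f (fst (D j)) = c}" for D :: "'a dataset"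
    unfolding mem_Collect_eq split_beta by simp_all
  ultimately show ?thesis
    using clopper_pearson_coverage[OF X(1) cell_sets(2)[of c] cell_sets(1)[of c False] _ e, of n]
    unfolding Let_def r_def dataset_dist_def count_cell_s0_def count_cell_def measure_cell cell_prob_def[symmetric]
    by simp
qed

text \<open>Identifies the mean that the test data estimate with the cell-weighted sum that bounds
  the optimal accuracy.\<close>

lemma integral_cell_function:
  fixes t :: "nat \<Rightarrow> real"
  defines "h \<equiv> \<lambda>x :: 'a \<times> bool. t (the_inv_into {1..k} z (f (fst x)))"
  shows "h \<in> borel_measurable X"
    and "(\<integral>x. h x \<partial>X) = (\<Sum>i\<in>{1..k}. t i * (cell_prob X f (z i) False + cell_prob X f (z i) True))"
proof -
  have h: "h = (\<lambda>x. \<Sum>i\<in>{1..k}. t i * indicator {(x, s'). f x = z i} x)"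
  proof
    fix x :: "'a \<times> bool"
    obtain i where i: "i \<in> {1..k}" "f (fst x) = z i"
      using cells by blast
    have "(\<Sum>l\<in>{1..k}. t l * indicator {(x, s'). f x = z l} x) = (\<Sum>l\<in>{1..k}. if i = l then t l else 0)"
      using i inj_on_eq_iff[OF inj] by (intro sum.cong) (auto simp: indicator_def split_beta)
    also have "\<dots> = h x"
      unfolding h_def i(2) the_inv_into_f_f[OF inj i(1)] using i(1) by simp
    finally show "h x = (\<Sum>l\<in>{1..k}. t l * indicator {(x, s'). f x = z l} x)" by simp
  qed
  show "h \<in> borel_measurable X"
    unfolding h using cell_sets(2) by measurable
  show "(\<integral>x. h x \<partial>X) = (\<Sum>i\<in>{1..k}. t i * (cell_prob X f (z i) False + cell_prob X f (z i) True))"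
    unfolding h measure_cell[symmetric] using cell_sets(2)
    by (subst Bochner_Integration.integral_sum) (auto simp: emeasure_eq_measure)
qed

lemma optimal_accuracy_le:
  fixes t :: "nat \<Rightarrow> real"
  defines "r \<equiv> \<lambda>i. cell_prob X f (z i) False / (cell_prob X f (z i) False + cell_prob X f (z i) True)"
  assumes A: "1 / (2 * measure X (UNIV \<times> {False})) \<le> A0" "1 / (2 * measure X (UNIV \<times> {True})) \<le> A1"
    and t: "\<And>i. i \<in> {1..k} \<Longrightarrow> A0 * r i \<le> t i" "\<And>i. i \<in> {1..k} \<Longrightarrow> A1 * (1 - r i) \<le> t i"
  shows "optimal_accuracy X f z k \<le> (\<Sum>i\<in>{1..k}. t i * (cell_prob X f (z i) False + cell_prob X f (z i) True))"
  unfolding optimal_accuracy_def sum_distrib_left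
proof (rule sum_mono)
  fix i assume i: "i \<in> {1..k}"
  define u v where "u = cell_prob X f (z i) False" and "v = cell_prob X f (z i) True"
  have uv: "0 \<le> u" "0 \<le> v" by (auto simp: u_def v_def cell_prob_def)
  \<comment> \<open>This also holds for a cell of probability 0, where \<open>u\<close> and
    \<open>v\<close> both vanish.\<close>
  have "u = (u + v) * r i" "v = (u + v) * (1 - r i)"
    using uv unfolding r_def u_def[symmetric] v_def[symmetric]
    by (cases "u + v = 0"; simp add: add_nonneg_eq_0_iff right_diff_distrib)+
  have "1 / (2 * measure X (UNIV \<times> {False})) * u \<le> A0 * u"
    using A(1) uv(1) by (rule mult_right_mono)
  also have "\<dots> = (u + v) * (A0 * r i)"
    using \<open>u = (u + v) * r i\<close> by (metis mult.left_commute)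
  also have "\<dots> \<le> (u + v) * t i"
    using t(1)[OF i] uv by (intro mult_left_mono) auto
  finally have 0: "1 / (2 * measure X (UNIV \<times> {False})) * u \<le> (u + v) * t i" .
  have "1 / (2 * measure X (UNIV \<times> {True})) * v \<le> A1 * v"
    using A(2) uv(2) by (rule mult_right_mono)
  also have "\<dots> = (u + v) * (A1 * (1 - r i))"
    using \<open>v = (u + v) * (1 - r i)\<close> by (metis mult.left_commute)
  also have "\<dots> \<le> (u + v) * t i"
    using t(2)[OF i] uv by (intro mult_left_mono) auto
  finally have 1: "1 / (2 * measure X (UNIV \<times> {True})) * v \<le> (u + v) * t i" .
  show "1 / 2 * max (cell_prob X f (z i) False / measure X (UNIV \<times> {False}))
      (cell_prob X f (z i) True / measure X (UNIV \<times> {True}))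
    \<le> t i * (cell_prob X f (z i) False + cell_prob X f (z i) True)"
    using 0 1 unfolding u_def[symmetric] v_def[symmetric] by (simp add: max_def mult.commute)
qed

lemma balanced_accuracy_optimal_eq:
  assumes "optimal_adversary (cond_repr_dist X f False) (cond_repr_dist X f True) h"
  shows "balanced_accuracy (cond_repr_dist X f False) (cond_repr_dist X f True) h = optimal_accuracy X f z k"
proof -
  have m: "measure (cond_repr_dist X f s) {c} = cell_prob X f c s / measure X (UNIV \<times> {s})" for s c
    unfolding cell_prob_def by (rule measure_cond_repr_dist_singleton[OF X f q])
  show ?thesis
    using balanced_accuracy_optimal[OF X f q finite_imageI[OF finite_atLeastAtMost] cells assms]
    unfolding m sum.reindex[OF inj] by (simp add: optimal_accuracy_def)
qed

text \<open>The parity bound always holds and all optimal adversaries share one accuracy, so only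
  the comparison with \<open>T\<close> carries information. This removes both quantifiers from the
  event.\<close>

lemma fairness_guarantee_iff:
  fixes T :: ereal
  defines "Z0 \<equiv> cond_repr_dist X f False" and "Z1 \<equiv> cond_repr_dist X f True"
  shows "(\<forall>h. optimal_adversary Z0 Z1 h \<longrightarrow> (\<forall>g\<in>classifiers.
      dp_distance Z0 Z1 g \<le> 2 * balanced_accuracy Z0 Z1 h - 1 \<and>
      ereal (2 * balanced_accuracy Z0 Z1 h - 1) \<le> T)) \<longleftrightarrow>
    ereal (2 * optimal_accuracy X f z k - 1) \<le> T"
proof -
  \<comment> \<open>Some classifier must exist for the bound by \<open>T\<close> to be extracted
    from the quantification over \<open>g\<close>.\<close>
  have "(\<lambda>_. True) \<in> (classifiers :: ('b \<Rightarrow> bool) set)"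
    by (simp add: classifiers_def)
  moreover obtain h where "optimal_adversary Z0 Z1 h"
    using ex_optimal_adversary[OF X f q _ cells] unfolding Z0_def Z1_def by auto
  ultimately show ?thesis
    using balanced_accuracy_optimal_eq dp_distance_le_balanced_accuracy_optimal[OF X f q _ cells]
    unfolding Z0_def Z1_def by (smt (verit) finite_atLeastAtMost finite_imageI)
qed


text \<open>The training data are fixed and their interval covers \<open>P (s = 0)\<close>. An
  infinite factor makes \<open>T_star\<close> infinite, so nothing can fail. Otherwise
  \<open>eps_c\<close> pays for cell intervals that miss and \<open>eps_s\<close> for the deviation
  of the test mean.\<close>

lemma T_star_failure_prob:
  fixes m :: nat
  assumes n: "nval \<ge> 1" "nte \<ge> 1"
    and eps: "0 < eps_b" "eps_b < 1" "0 < eps_c" "eps_c < 1" "0 < eps_s" "eps_s < 1"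
    and m_def: "m = count_s0 ntr Dtr"
    and cov: "beta_quantile (eps_b / 2) (real m) (real ntr - real m + 1) \<le> measure X (UNIV \<times> {False})"
      "measure X (UNIV \<times> {False}) \<le> beta_quantile (1 - eps_b / 2) (real m + 1) (real ntr - real m)"
    and S: "{\<omega> \<in> space (dataset_dist nval X \<Otimes>\<^sub>M dataset_dist nte X).
        \<not> ereal (2 * optimal_accuracy X f z k - 1)
          \<le> T_star eps_b eps_c eps_s k ntr nval nte f z Dtr (fst \<omega>) (snd \<omega>)}
      \<in> sets (dataset_dist nval X \<Otimes>\<^sub>M dataset_dist nte X)" (is "?S \<in> _")
  shows "measure (dataset_dist nval X \<Otimes>\<^sub>M dataset_dist nte X) ?S \<le> eps_c + eps_s"
proof (cases "alpha0 eps_b ntr m = \<infinity> \<or> alpha1 eps_b ntr m = \<infinity>")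
  case True
  then have "T_star eps_b eps_c eps_s k ntr nval nte f z Dtr D D' = \<infinity>" for D D'
    by (intro T_star_infinite) (simp add: m_def)
  then have "?S = {}" by simp
  then show ?thesis using eps by (simp only: measure_empty)
next
  case False
  define L U where "L = beta_quantile (eps_b / 2) (real m) (real ntr - real m + 1)"
    and "U = beta_quantile (1 - eps_b / 2) (real m + 1) (real ntr - real m)"
  define A0 A1 where "A0 = 1 / (2 * L)" and "A1 = 1 / (2 * (1 - U))"
  have m: "m \<le> ntr" by (simp add: m_def count_s0_le)
  have LU: "0 \<le> L" "U \<le> 1"
    using eps beta_quantile_lower_nonneg[OF m] beta_quantile_upper_le_1[OF m] by (auto simp: L_def U_def)
  \<comment> \<open>A zero denominator would give an infinite factor, which this case
    excludes.\<close>
  have "L \<noteq> 0" "U \<noteq> 1"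
    using False by (auto simp: alpha0_def alpha1_def L_def U_def zero_ereal_def[symmetric])
  with LU have LU': "0 < L" "U < 1" by auto
  have alpha: "alpha0 eps_b ntr (count_s0 ntr Dtr) = ereal A0" "alpha1 eps_b ntr (count_s0 ntr Dtr) = ereal A1"
    using LU' unfolding m_def[symmetric] alpha0_def alpha1_def A0_def A1_def L_def[symmetric] U_def[symmetric]
    by (simp_all add: one_ereal_def)
  have q01: "measure X (UNIV \<times> {True}) = 1 - measure X (UNIV \<times> {False})"
  proof -
    have "UNIV \<times> {True} = space X - UNIV \<times> {False}"
      by (auto simp: space_sample_algebra[OF X(2)])
    then show ?thesis
      using prob_compl[of "UNIV \<times> {False}"] by (simp add: X(2) UNIV_times_in_sample_algebra)
  qed
  \<comment> \<open>The lower limit for \<open>P (s = 0)\<close> yields \<open>A0\<close>; the upper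
    limit becomes a lower limit for \<open>P (s = 1)\<close> and yields \<open>A1\<close>.\<close>
  have A: "1 / (2 * measure X (UNIV \<times> {False})) \<le> A0" "1 / (2 * measure X (UNIV \<times> {True})) \<le> A1"
    unfolding A0_def A1_def using LU' cov q[of True]
    by (intro divide_left_mono; simp add: L_def U_def q01)+
  have A_nonneg: "0 \<le> A0" "0 \<le> A1" using LU' by (auto simp: A0_def A1_def)
  define e where "e = eps_c / (2 * real k)"
  have e: "0 < e" "e < 1" using eps k by (auto simp: e_def field_simps)
  define r where "r i = cell_prob X f (z i) False / (cell_prob X f (z i) False + cell_prob X f (z i) True)" for i
  let ?M = "dataset_dist nval X" and ?N = "dataset_dist nte X"
  \<comment> \<open>\<open>F i\<close> is the event that the interval of cell \<open>i\<close>
    misses \<open>r i\<close>. It costs \<open>2 * e\<close>, so the union over \<open>k\<close>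
    cells costs \<open>eps_c\<close>.\<close>
  define F where "F i = {D \<in> space ?M.
      \<not> (beta_quantile e (real (count_cell_s0 nval f (z i) D)) (real (count_cell nval f (z i) D) - real (count_cell_s0 nval f (z i) D) + 1) \<le> r i \<and>
        r i \<le> beta_quantile (1 - e) (real (count_cell_s0 nval f (z i) D) + 1) (real (count_cell nval f (z i) D) - real (count_cell_s0 nval f (z i) D)))}"
    for i
  have MN: "prob_space ?M" "prob_space ?N"
    unfolding dataset_dist_def by (intro prob_space_PiM X(1))+
  interpret M: prob_space ?M by (rule MN)
  interpret N: prob_space ?N by (rule MN)
  \<comment> \<open>The encoder no longer varies, so a one-point space plays the role of the
    training data.\<close>
  have counts: "count_cell nval f c \<in> ?M \<rightarrow>\<^sub>M count_space UNIV"
      "count_cell_s0 nval f c \<in> ?M \<rightarrow>\<^sub>M count_space UNIV" for c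
    using measurable_count_cell[OF X(2), of "\<lambda>_. f" "count_space {()}" "\<lambda>_. c" "\<lambda>_. ()" ?M "\<lambda>D. D" nval] f
    by (simp_all add: measurable_split_conv measurable_compose[OF measurable_snd f])
  have F_sets: "F i \<in> sets ?M" for i
    unfolding F_def
    by (rule predE, rule measurable_compose_countable[OF _ counts(1)[of "z i"]],
        rule measurable_compose[OF counts(2)[of "z i"]]) simp
  have F_measure: "measure ?M (F i) \<le> 2 * e" for i
    unfolding F_def r_def by (rule cell_coverage[OF e])
  show ?thesis
  proof (rule prob_pair_measure_le[OF MN S])
    show "(\<Union>i\<in>{1..k}. F i) \<in> sets ?M" using F_sets by auto
    have "measure ?M (\<Union>i\<in>{1..k}. F i) \<le> (\<Sum>i\<in>{1..k}. measure ?M (F i))"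
      using F_sets by (intro M.finite_measure_subadditive_finite) auto
    also have "\<dots> \<le> (\<Sum>i\<in>{1..k}. 2 * e)" by (intro sum_mono F_measure)
    also have "\<dots> = eps_c" using k by (simp add: e_def)
    finally show "measure ?M (\<Union>i\<in>{1..k}. F i) \<le> eps_c" .
    show "0 \<le> eps_s" using eps by simp
    fix D assume D: "D \<in> space ?M" "D \<notin> (\<Union>i\<in>{1..k}. F i)"
    \<comment> \<open>With \<open>D\<close> fixed, \<open>t\<close> is deterministic and
      \<open>h\<close> is a function of a single test sample with values between \<open>?a\<close>
      and \<open>?b\<close>.\<close>
    define t where "t i = real_cell_bound A0 A1 e (count_cell nval f (z i) D) (count_cell_s0 nval f (z i) D)" for i
    define h where "h x = t (the_inv_into {1..k} z (f (fst x)))" for x :: "'a \<times> bool"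
    let ?a = "Min (t ` {1..k})" and ?b = "Max (t ` {1..k})"
    have t: "A0 * r i \<le> t i" "A1 * (1 - r i) \<le> t i" if "i \<in> {1..k}" for i
    proof -
      have "D \<notin> F i" using D that by auto
      with D(1) have "beta_quantile e (real (count_cell_s0 nval f (z i) D)) (real (count_cell nval f (z i) D) - real (count_cell_s0 nval f (z i) D) + 1) \<le> r i"
        "r i \<le> beta_quantile (1 - e) (real (count_cell_s0 nval f (z i) D) + 1) (real (count_cell nval f (z i) D) - real (count_cell_s0 nval f (z i) D))"
        by (auto simp: F_def)
      then show "A0 * r i \<le> t i" "A1 * (1 - r i) \<le> t i"
        unfolding t_def real_cell_bound_def
        by (auto intro: max.coboundedI1[OF mult_left_mono[OF _ A_nonneg(1)]]
            max.coboundedI2[OF mult_left_mono[OF _ A_nonneg(2)]])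
    qed
    have acc: "optimal_accuracy X f z k \<le> (\<integral>x. h x \<partial>X)"
      unfolding h_def integral_cell_function(2)
      using A t by (intro optimal_accuracy_le[of A0 A1]) (auto simp: r_def)
    have h: "h \<in> borel_measurable X"
      unfolding h_def by (rule integral_cell_function(1))
    have ab: "?a \<le> h x \<and> h x \<le> ?b" for x
    proof -
      have "the_inv_into {1..k} z (f (fst x)) \<in> {1..k}"
        using cells by (intro the_inv_into_into[OF inj]) auto
      then show ?thesis unfolding h_def by (intro conjI Min_le Max_ge) auto
    qed
    let ?H = "{D' \<in> space (Pi\<^sub>M {..<nte} (\<lambda>_. X)). 1 / real nte * (\<Sum>j<nte. h (D' j))
        + (?b - ?a) * sqrt (- ln eps_s / (2 * real nte)) < (\<integral>x. h x \<partial>X)}"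
    \<comment> \<open>By \<open>acc\<close> the optimal accuracy is at most the mean of
      \<open>h\<close>, so a failure of the guarantee forces the empirical bound below that
      mean.\<close>
    have "Pair D -` ?S \<subseteq> ?H"
    proof
      fix D' assume D': "D' \<in> Pair D -` ?S"
      then have sp: "D' \<in> space ?N" by (simp add: space_pair_measure)
      have "\<not> ereal (2 * optimal_accuracy X f z k - 1)
          \<le> T_star eps_b eps_c eps_s k ntr nval nte f z Dtr D D'"
        using D' by simp
      then have "\<not> 2 * optimal_accuracy X f z k - 1 \<le> 2 * (1 / real nte * (\<Sum>j<nte. h (D' j))
        + (?b - ?a) * sqrt (- ln eps_s / (2 * real nte))) - 1"
        unfolding T_star_def S_star_real[OF alpha k] e_def[symmetric] t_def[symmetric] h_def
        by (simp add: one_ereal_def)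
      with acc sp show "D' \<in> ?H" by (simp add: dataset_dist_def)
    qed
    moreover have "?H \<in> sets ?N"
    proof -
      have [measurable]: "(\<lambda>D'. h (D' j)) \<in> borel_measurable (Pi\<^sub>M {..<nte} (\<lambda>_. X))" if "j \<in> {..<nte}" for j
        by (rule measurable_compose[OF measurable_component_singleton[OF that] h])
      show ?thesis unfolding dataset_dist_def by measurable
    qed
    ultimately have "measure ?N (Pair D -` ?S) \<le> measure ?N ?H"
      by (intro N.finite_measure_mono)
    also have "\<dots> \<le> eps_s"
      unfolding dataset_dist_def using ab n eps by (intro hoeffding_PiM X(1) h) auto
    finally show "measure ?N (Pair D -` ?S) \<le> eps_s" .
  qed
qed

end

section \<open>The guarantee over all three data sets\<close>

theorem mainTheorem1:
  fixes X :: "((real ^ 'd) \<times> bool) measure"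
    and k ntr nval nte :: nat
    and f :: "(real ^ 'd) dataset \<Rightarrow> real ^ 'd \<Rightarrow> real ^ 'e"
    and z :: "(real ^ 'd) dataset \<Rightarrow> nat \<Rightarrow> real ^ 'e"
    and eps eps_b eps_c eps_s :: real
  assumes X: "prob_space X" "sets X = sets sample_algebra"
    and q: "measure X {(x, s). s = False} > 0" "measure X {(x, s). s = True} > 0"
    and n: "ntr \<ge> 1" "nval \<ge> 1" "nte \<ge> 1"
    and k: "k \<ge> 1"
    and f_measurable:
      "(\<lambda>(D, x). f D x) \<in> dataset_dist ntr X \<Otimes>\<^sub>M borel \<rightarrow>\<^sub>M borel"
    and z_measurable:
      "\<And>i. i \<in> {1..k} \<Longrightarrow> (\<lambda>D. z D i) \<in> dataset_dist ntr X \<rightarrow>\<^sub>M borel"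
    and z_distinct: "\<And>D. D \<in> space (dataset_dist ntr X) \<Longrightarrow> inj_on (z D) {1..k}"
    and f_cells: "\<And>D x. D \<in> space (dataset_dist ntr X) \<Longrightarrow> f D x \<in> z D ` {1..k}"
    and eps: "eps = eps_b + eps_c + eps_s" "0 < eps" "eps < 1"
      "eps_b > 0" "eps_c > 0" "eps_s > 0"
  shows "measure (dataset_dist ntr X \<Otimes>\<^sub>M dataset_dist nval X \<Otimes>\<^sub>M dataset_dist nte X)
     {(Dtr, Dval, Dte) \<in>
         space (dataset_dist ntr X \<Otimes>\<^sub>M dataset_dist nval X \<Otimes>\<^sub>M dataset_dist nte X).
        let Z0 = cond_repr_dist X (f Dtr) False;
            Z1 = cond_repr_dist X (f Dtr) True
        in \<forall>hstar. optimal_adversary Z0 Z1 hstar \<longrightarrow>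
             (\<forall>g\<in>classifiers.
                dp_distance Z0 Z1 g \<le> 2 * balanced_accuracy Z0 Z1 hstar - 1 \<and>
                ereal (2 * balanced_accuracy Z0 Z1 hstar - 1)
                  \<le> T_star eps_b eps_c eps_s k ntr nval nte (f Dtr) (z Dtr) Dtr Dval Dte)}
     \<ge> 1 - eps"
proof -
  interpret X: prob_space X by (rule X(1))
  let ?M1 = "dataset_dist ntr X" and ?M2 = "dataset_dist nval X" and ?M3 = "dataset_dist nte X"
  let ?P = "?M1 \<Otimes>\<^sub>M ?M2 \<Otimes>\<^sub>M ?M3"
  have M: "prob_space (dataset_dist m X)" for m
    unfolding dataset_dist_def by (intro prob_space_PiM X(1))
  interpret M2: prob_space ?M2 by (rule M)
  interpret M3: prob_space ?M3 by (rule M)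
  interpret M1: prob_space ?M1 by (rule M)
  interpret M23: pair_prob_space ?M2 ?M3 by unfold_locales
  interpret M123: pair_prob_space ?M1 "?M2 \<Otimes>\<^sub>M ?M3" by unfold_locales
  have qs: "measure X (UNIV \<times> {s}) > 0" for s
  proof -
    have "{(x, s). s = False} = (UNIV :: (real ^ 'd) set) \<times> {False}"
        "{(x, s). s = True} = (UNIV :: (real ^ 'd) set) \<times> {True}" by auto
    with q show ?thesis by (cases s) (simp_all only:)
  qed
  have f_meas: "f D \<in> borel_measurable borel" if "D \<in> space ?M1" for D
    using measurable_compose[OF measurable_Pair1'[OF that] f_measurable] by simp
  have cells: "range (f D) \<subseteq> z D ` {1..k}" if "D \<in> space ?M1" for D
    using f_cells[OF that] by blast
  define T where "T = (\<lambda>(Dtr, Dval, Dte). T_star eps_b eps_c eps_s k ntr nval nte (f Dtr) (z Dtr) Dtr Dval Dte)"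
  have T: "T \<in> borel_measurable ?P"
    unfolding T_def by (rule measurable_T_star[OF X(2) k f_measurable z_measurable z_distinct f_cells])
  have V: "(\<lambda>\<omega>. ereal (2 * optimal_accuracy X (f (fst \<omega>)) (z (fst \<omega>)) k - 1)) \<in> borel_measurable ?P"
  proof -
    have [measurable]: "(\<lambda>\<omega>. optimal_accuracy X (f (fst \<omega>)) (z (fst \<omega>)) k) \<in> borel_measurable ?P"
      by (rule measurable_compose[OF measurable_fst measurable_optimal_accuracy[OF X f_measurable z_measurable]])
    show ?thesis by measurable
  qed
  let ?B = "{\<omega> \<in> space ?P. \<not> ereal (2 * optimal_accuracy X (f (fst \<omega>)) (z (fst \<omega>)) k - 1) \<le> T \<omega>}"
  have B: "?B \<in> sets ?P"
    using T V by measurable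
  let ?G = "{(Dtr, Dval, Dte) \<in> space ?P.
        let Z0 = cond_repr_dist X (f Dtr) False;
            Z1 = cond_repr_dist X (f Dtr) True
        in \<forall>hstar. optimal_adversary Z0 Z1 hstar \<longrightarrow>
             (\<forall>g\<in>classifiers.
                dp_distance Z0 Z1 g \<le> 2 * balanced_accuracy Z0 Z1 hstar - 1 \<and>
                ereal (2 * balanced_accuracy Z0 Z1 hstar - 1)
                  \<le> T_star eps_b eps_c eps_s k ntr nval nte (f Dtr) (z Dtr) Dtr Dval Dte)}"
  \<comment> \<open>This makes the event measurable and reduces the claim to an upper bound for the
    probability of \<open>?B\<close>.\<close>
  have "?G = space ?P - ?B"
  proof (intro set_eqI)
    fix \<omega> :: "(real ^ 'd) dataset \<times> (real ^ 'd) dataset \<times> (real ^ 'd) dataset"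
    obtain Dtr Dval Dte where \<omega>: "\<omega> = (Dtr, Dval, Dte)" by (cases \<omega>)
    show "\<omega> \<in> ?G \<longleftrightarrow> \<omega> \<in> space ?P - ?B"
    proof (cases "\<omega> \<in> space ?P")
      case True
      then have D: "Dtr \<in> space ?M1" by (simp add: \<omega> space_pair_measure)
      from fairness_guarantee_iff[OF X f_meas[OF D] qs k z_distinct[OF D] cells[OF D]]
      show ?thesis using True by (simp add: \<omega> T_def Let_def)
    qed (simp add: \<omega>)
  qed
  \<comment> \<open>Outermost split: training data whose interval misses \<open>P (s = 0)\<close>
    cost \<open>eps_b\<close>. For all others the bound for a fixed encoder applies to the
    validation and test data.\<close>
  moreover have "measure ?P ?B \<le> eps_b + (eps_c + eps_s)"
  proof (rule prob_pair_measure_le[OF M M23.prob_space_axioms B])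
    let ?q = "measure X (UNIV \<times> {False})"
    let ?A = "{D \<in> space ?M1.
      \<not> (beta_quantile (eps_b / 2) (real (count_s0 ntr D)) (real ntr - real (count_s0 ntr D) + 1) \<le> ?q \<and>
        ?q \<le> beta_quantile (1 - eps_b / 2) (real (count_s0 ntr D) + 1) (real ntr - real (count_s0 ntr D)))}"
    show "?A \<in> sets ?M1"
      by (rule predE, rule measurable_compose[OF measurable_count_s0[OF X(2)]]) simp
    show "measure ?M1 ?A \<le> eps_b"
      using class_prob_coverage[OF X, of "eps_b / 2" ntr] eps by simp
    show "0 \<le> eps_c + eps_s" using eps by simp
    fix D assume D: "D \<in> space ?M1" "D \<notin> ?A"
    have "Pair D -` ?B = {\<omega> \<in> space (?M2 \<Otimes>\<^sub>M ?M3). \<not> ereal (2 * optimal_accuracy X (f D) (z D) k - 1)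
        \<le> T_star eps_b eps_c eps_s k ntr nval nte (f D) (z D) D (fst \<omega>) (snd \<omega>)}" (is "_ = ?S")
      using D(1) by (auto simp: space_pair_measure T_def)
    moreover have "measure (?M2 \<Otimes>\<^sub>M ?M3) ?S \<le> eps_c + eps_s"
    proof (rule T_star_failure_prob[OF X f_meas[OF D(1)] qs k z_distinct[OF D(1)] cells[OF D(1)] n(2,3) _ _ _ _ _ _ refl])
      show "?S \<in> sets (?M2 \<Otimes>\<^sub>M ?M3)"
        using sets_Pair1[OF B, of D] \<open>Pair D -` ?B = ?S\<close> by simp
    qed (use D eps in auto)
    ultimately show "measure (?M2 \<Otimes>\<^sub>M ?M3) (Pair D -` ?B) \<le> eps_c + eps_s" by simp
  qed
  ultimately show ?thesis
    using M123.prob_compl[OF B] eps(1) by simp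
qed

end
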